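(* For every integer $k>1$, let $h_k=\frac{3}{2}k^2-\frac{3}{2}k$ and $n_k=\frac{9}{2}k^2+\frac{3}{2}k-2$. Then $g_{\triangle}(h_k)=n_k$.
   Context: A polyiamond is a planar shape formed by gluing together finitely many congruent (closed) equilateral triangles (tiles) of the regular triangular lattice along their edges: any two tiles that intersect meet in an entire edge, and the union has connected interior. Polyiamonds are considered up to isometry. The number of tiles of a polyiamond $A$ is $|A|$. The number of holes $h(A)$ of $A$ is the number of bounded connected components of $\mathbb{R}^2\setminus A$. For $h\ge 1$, $g_{\triangle}(h)$ denotes the minimum of $|A|$ over all polyiamonds $A$ with $h(A)=h$. *)

theory Defs
  imports "HOL-Analysis.Analysis"
begin

definition omega :: complex where
  "omega = cis (pi / 3)"

definition lattice_pt :: "int \<Rightarrow> int \<Rightarrow> complex" where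
  "lattice_pt a b = of_int a + of_int b * omega"

definition up_tile :: "int \<Rightarrow> int \<Rightarrow> complex set" where
  "up_tile a b = convex hull {lattice_pt a b, lattice_pt (a+1) b, lattice_pt a (b+1)}"

definition down_tile :: "int \<Rightarrow> int \<Rightarrow> complex set" where
  "down_tile a b = convex hull {lattice_pt (a+1) b, lattice_pt a (b+1), lattice_pt (a+1) (b+1)}"

definition tiles :: "complex set set" where
  "tiles = {up_tile a b | a b. True} \<union> {down_tile a b | a b. True}"

definition polyiamond_tiles :: "complex set set \<Rightarrow> bool" where
  "polyiamond_tiles T \<longleftrightarrow> finite T \<and> T \<noteq> {} \<and> T \<subseteq> tiles \<and> connected (interior (\<Union>T))"

definition holes :: "complex set \<Rightarrow> nat" where
  "holes A = card {C \<in> components (- A). bounded C}"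

definition g_tri :: "nat \<Rightarrow> nat" where
  "g_tri h = (LEAST n. \<exists>T. polyiamond_tiles T \<and> holes (\<Union>T) = h \<and> card T = n)"

end

theory Submission
  imports Defs
begin

text \<open>
  Lower bound. The dual graph of a polyiamond with \<open>n\<close> tiles is connected, hence has at least
  \<open>n - 1\<close> edges, so at most \<open>3 n - 2 (n - 1) = n + 2\<close> tile edges are on the boundary. Each hole
  takes up at least three of them, and the remaining \<open>p\<close> edges bound the polyiamond with its
  holes filled, which has at least \<open>n + h\<close> tiles. With the isoperimetric inequality
  \<open>6 \<cdot> area \<le> perimeter\<^sup>2\<close> this gives \<open>3 h + p \<le> n + 2\<close> and \<open>6 (n + h) \<le> p\<^sup>2\<close>, which is
  impossible for \<open>h = h\<^sub>k\<close> and \<open>n < n\<^sub>k\<close>, and also for \<open>h > h\<^sub>k\<close> and \<open>n \<le> n\<^sub>k\<close>.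

  Construction. Start from the triangle of side 2 and repeatedly add a ring of triangles around
  it, obtaining hexagons with alternating sides \<open>k - 1\<close> and \<open>k + 1\<close>, perimeter \<open>6 k\<close> and \<open>6 k\<^sup>2 - 2\<close>
  triangles. When passing from \<open>k\<close> to \<open>k + 1\<close>, leave out every other one of the \<open>6 k\<close> triangles
  that share an edge with the old hexagon.
\<close>

section \<open>The triangular grid\<close>

text \<open>The triple \<open>(i, j, l)\<close> stands for the triangle in row \<open>i\<close>, \<open>j\<close>, \<open>l\<close> of the three
  directions of the grid. It points up if \<open>i + j + l = 0\<close> and down if \<open>i + j + l = -1\<close>.\<close>

type_synonym tri = "int \<times> int \<times> int"

definition tris :: "tri set" where
  "tris = {(i, j, l). i + j + l = 0 \<or> i + j + l = -1}"

text \<open>As both index sums lie in {0, -1}, triples that differ in a single coordinate differ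
  there by exactly 1. So adjacent triangles share an edge and point in opposite directions.\<close>

fun adj :: "tri \<Rightarrow> tri \<Rightarrow> bool" where
  "adj (i, j, l) (i', j', l') \<longleftrightarrow> (i, j, l) \<in> tris \<and> (i', j', l') \<in> tris \<and>
     (i \<noteq> i' \<and> j = j' \<and> l = l' \<or> i = i' \<and> j \<noteq> j' \<and> l = l' \<or> i = i' \<and> j = j' \<and> l \<noteq> l')"

text \<open>The pairs point outwards, so each boundary edge occurs once, and
  \<open>prod.swap\<close> turns an edge seen from a hole into the same edge seen from the
  polyiamond.\<close>

definition bd :: "tri set \<Rightarrow> (tri \<times> tri) set" where
  "bd F = {(t, t'). t \<in> F \<and> t' \<notin> F \<and> adj t t'}"

text \<open>The row sets need not be intervals: an induction can delete single rows, and every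
  subset of \<open>tris\<close> lies in the box of its own rows.\<close>

definition tri_box :: "int set \<Rightarrow> int set \<Rightarrow> int set \<Rightarrow> tri set" where
  "tri_box A B C = tris \<inter> A \<times> B \<times> C"

text \<open>Rotation by 120 degrees about the centre of the triangle (0, 0, 0). It reduces claims
  about the three directions to one of them.\<close>

fun rot :: "tri \<Rightarrow> tri" where
  "rot (i, j, l) = (j, l, i)"

lemma inj_rot: "inj rot"
  by (auto simp: inj_def)

lemma tris_rot: "(j, l, i) \<in> tris \<longleftrightarrow> (i, j, l) \<in> tris"
  by (auto simp: tris_def algebra_simps)

lemma adj_rot [simp]: "adj (rot t) (rot t') \<longleftrightarrow> adj t t'"
  by (cases t; cases t') (simp only: rot.simps adj.simps tris_rot, blast)

lemma adj_sym: "adj t t' \<longleftrightarrow> adj t' t"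
  by (cases t; cases t') auto

lemma adj_tris: "adj t t' \<Longrightarrow> t \<in> tris" "adj t t' \<Longrightarrow> t' \<in> tris"
  by (cases t; cases t'; auto)+

declare adj.simps [simp del]

text \<open>Up triangles have index sum 0 and can only lower a coordinate, down triangles can only
  raise one; \<open>d\<close> is the corresponding sign.\<close>

lemma neighbours:
  assumes "(i, j, l) \<in> tris"
  defines "d \<equiv> - 1 - 2 * (i + j + l)"
  shows "{t. adj (i, j, l) t} = {(i + d, j, l), (i, j + d, l), (i, j, l + d)}"
proof -
  have "i + j + l = 0 \<and> d = -1 \<or> i + j + l = -1 \<and> d = 1"
    using assms by (auto simp: tris_def)
  then have "adj (i, j, l) (a, b, c) \<longleftrightarrow>
      (a, b, c) = (i + d, j, l) \<or> (a, b, c) = (i, j + d, l) \<or> (a, b, c) = (i, j, l + d)"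
    for a b c
    unfolding adj.simps tris_def mem_Collect_eq prod.case prod.inject
    by (intro iffI; elim disjE conjE) simp_all
  then have "adj (i, j, l) t \<longleftrightarrow> t \<in> {(i + d, j, l), (i, j + d, l), (i, j, l + d)}" for t
    by (cases t) (simp only: insert_iff empty_iff simp_thms)
  then show ?thesis by blast
qed

lemma finite_neighbours [simp]: "finite {t'. adj t t'}"
proof (cases "t \<in> tris")
  case True
  obtain i j l where "t = (i, j, l)" by (cases t)
  with True show ?thesis by (simp only: neighbours finite_insert finite.emptyI)
next
  case False
  then have "{t'. adj t t'} = {}" using adj_tris by blast
  then show ?thesis by (simp only: finite.emptyI)
qed

lemma card_neighbours:
  assumes "t \<in> tris"
  shows "card {t'. adj t t'} = 3"
proof -
  obtain i j l where t: "t = (i, j, l)" by (cases t)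
  define d where "d = - 1 - 2 * (i + j + l)"
  have "d \<noteq> 0" unfolding d_def by presburger
  then have "card {(i + d, j, l), (i, j + d, l), (i, j, l + d)} = 3" by simp
  then show ?thesis using neighbours[of i j l] assms t unfolding d_def by metis
qed

lemma finite_bd [simp]: "finite F \<Longrightarrow> finite (bd F)"
proof -
  assume "finite F"
  moreover have "bd F \<subseteq> (SIGMA t:F. {t'. adj t t'})" by (auto simp: bd_def)
  ultimately show ?thesis by (meson finite_SigmaI finite_subset finite_neighbours)
qed

text \<open>The edge between \<open>s\<close> and \<open>t\<close> leaves the boundary, and
  \<open>t\<close> contributes at most its two other edges.\<close>

lemma card_bd_insert:
  assumes "finite S" "s \<in> S" "t \<notin> S" "adj s t"
  shows "card (bd (insert t S)) \<le> card (bd S) + 1"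
proof -
  have st: "(s, t) \<in> bd S" using assms by (auto simp: bd_def)
  have sub: "bd (insert t S) \<subseteq> (bd S - {(s, t)}) \<union> {t} \<times> ({t'. adj t t'} - {s})"
    using assms(2) by (auto simp: bd_def)
  have "card (bd (insert t S)) \<le> card ((bd S - {(s, t)}) \<union> {t} \<times> ({t'. adj t t'} - {s}))"
    by (rule card_mono[OF _ sub]) (simp add: assms)
  also have "\<dots> \<le> card (bd S - {(s, t)}) + card ({t} \<times> ({t'. adj t t'} - {s}))"
    by (rule card_Un_le)
  also have "card ({t} \<times> ({t'. adj t t'} - {s})) = 2"
  proof -
    have "adj t s" "t \<in> tris" using assms(4) adj_sym adj_tris(2) by blast+
    then show ?thesis
      using card_neighbours[of t] by (simp add: card_cartesian_product card_Diff_singleton)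
  qed
  also have "card (bd S - {(s, t)}) + 2 = card (bd S) + 1"
    using card_Suc_Diff1[OF finite_bd[OF assms(1)] st] by simp
  finally show ?thesis .
qed

text \<open>Connectivity of the dual graph, phrased through cuts: this form lets a set be built up
  tile by tile, and a violated cut separates the interior topologically.\<close>

definition edge_connected :: "tri set \<Rightarrow> bool" where
  "edge_connected F \<longleftrightarrow> (\<forall>S. S \<noteq> {} \<longrightarrow> S \<subset> F \<longrightarrow> (\<exists>s\<in>S. \<exists>t\<in>F - S. adj s t))"

text \<open>Grow \<open>F\<close> from one triangle with three boundary edges; each further tile is
  attached along an edge and adds at most one to the boundary.\<close>

lemma edge_connected_card_bd:
  assumes "finite F" "F \<noteq> {}" "F \<subseteq> tris" "edge_connected F"
  shows "card (bd F) \<le> card F + 2"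
proof -
  have "\<exists>S\<subseteq>F. card S = Suc n \<and> card (bd S) \<le> Suc n + 2" if "Suc n \<le> card F" for n
    using that
  proof (induction n)
    case 0
    obtain t where t: "t \<in> F" using assms by auto
    have sub: "bd {t} \<subseteq> {t} \<times> {t'. adj t t'}" by (auto simp: bd_def)
    have "card (bd {t}) \<le> card ({t} \<times> {t'. adj t t'})"
      by (rule card_mono[OF _ sub]) simp
    also have "\<dots> = 3"
      using card_neighbours[of t] t assms(3) by (simp add: card_cartesian_product subsetD)
    finally show ?case using t by (intro exI[of _ "{t}"]) auto
  next
    case (Suc n)
    then obtain S where S: "S \<subseteq> F" "card S = Suc n" "card (bd S) \<le> Suc n + 2" by auto
    then have "S \<noteq> {}" "S \<subset> F" using Suc.prems by auto
    then obtain s t where st: "s \<in> S" "t \<in> F - S" "adj s t"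
      using assms(4) unfolding edge_connected_def by meson
    have fin: "finite S" using S assms finite_subset by auto
    show ?case
      using st S fin card_bd_insert[OF fin st(1) _ st(3)]
      by (intro exI[of _ "insert t S"]) auto
  qed
  from this[of "card F - 1"] assms obtain S where
    "S \<subseteq> F" "card S = card F" "card (bd S) \<le> card F + 2"
    by (auto simp: card_gt_0_iff Suc_leI)
  moreover from this have "S = F" using assms card_subset_eq by blast
  ultimately show ?thesis by simp
qed

section \<open>The isoperimetric inequality\<close>

lemma rot_tri_box: "rot ` tri_box A B C = tri_box B C A"
proof (intro equalityI subsetI)
  fix t assume t: "t \<in> tri_box B C A"
  obtain j l i where "t = (j, l, i)" by (cases t)
  with t have "(i, j, l) \<in> tri_box A B C" "t = rot (i, j, l)" by (auto simp: tri_box_def tris_rot)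
  then show "t \<in> rot ` tri_box A B C" by blast
qed (auto simp: tri_box_def tris_rot)

lemma card_tri_box_rot: "card (tri_box A B C) = card (tri_box B C A)"
  using card_image[OF inj_on_subset[OF inj_rot subset_UNIV]] rot_tri_box by metis

lemma finite_tri_box [simp]: "finite A \<Longrightarrow> finite B \<Longrightarrow> finite C \<Longrightarrow> finite (tri_box A B C)"
  by (auto simp: tri_box_def)

text \<open>The triangles of the box lying in row \<open>Min A\<close> or in row \<open>Max B\<close> have pairwise
  distinct values of \<open>i + j\<close>, so each \<open>l\<close> accounts for at most two of them.\<close>

lemma card_tri_box_remove:
  assumes fin: "finite A" "finite B" "finite C" and ne: "A \<noteq> {}" "B \<noteq> {}"
  obtains a b where "a \<in> A" "b \<in> B"
    "card (tri_box A B C) \<le> card (tri_box (A - {a}) (B - {b}) C) + 2 * card C"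
proof -
  define a where "a = Min A"
  define b where "b = Max B"
  have ab: "a \<in> A" "b \<in> B" "\<And>x. x \<in> A \<Longrightarrow> a \<le> x" "\<And>x. x \<in> B \<Longrightarrow> x \<le> b"
    using assms by (auto simp: a_def b_def)
  define D where "D = tri_box A B C - tri_box (A - {a}) (B - {b}) C"
  have D: "i = a \<or> j = b" "a \<le> i" "j \<le> b" "l \<in> C" "i + j + l = 0 \<or> i + j + l = -1"
    if "(i, j, l) \<in> D" for i j l
    using that ab by (auto simp: D_def tri_box_def tris_def)
  \<comment> \<open>Members of \<open>D\<close> in row \<open>a\<close> have i + j at most a + b,
    those with j = b have at least a + b. Equal sums across the two rows thus occur only at the
    corner.\<close>
  have inj: "inj_on (\<lambda>(i, j, l). (l, i + j + l)) D"
  proof (rule inj_onI)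
    fix t t'
    assume *: "t \<in> D" "t' \<in> D" "(case t of (i, j, l) \<Rightarrow> (l, i + j + l)) = (case t' of (i, j, l) \<Rightarrow> (l, i + j + l))"
    obtain i j l i' j' l' where t: "t = (i, j, l)" "t' = (i', j', l')" by (metis prod_cases3)
    then have "l = l'" "i + j = i' + j'" using *(3) by auto
    then show "t = t'"
      using D(1-3)[OF *(1)[unfolded t]] D(1-3)[OF *(2)[unfolded t]] unfolding t by auto
  qed
  have im: "(\<lambda>(i, j, l). (l, i + j + l)) ` D \<subseteq> C \<times> {0, -1}"
  proof (rule image_subsetI)
    fix t assume "t \<in> D"
    then show "(case t of (i, j, l) \<Rightarrow> (l, i + j + l)) \<in> C \<times> {0, -1}"
      using D(4,5) by (cases t) simp
  qed
  have "card D \<le> card (C \<times> {0, -1::int})"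
    using card_inj_on_le[OF inj im] fin by simp
  then have "card D \<le> 2 * card C" by (simp add: card_cartesian_product)
  moreover have "tri_box A B C \<subseteq> tri_box (A - {a}) (B - {b}) C \<union> D" by (auto simp: D_def)
  then have "card (tri_box A B C) \<le> card (tri_box (A - {a}) (B - {b}) C) + card D"
    by (intro order.trans[OF card_mono card_Un_le]) (use fin in \<open>auto simp: D_def\<close>)
  ultimately show ?thesis using that[OF ab(1,2)] by linarith
qed

text \<open>Induction on the total number of rows. If the three counts differ, rotate so that C has
  the fewest rows and delete a row from each of A and B. This costs at most 2 |C| triangles, while
  the total drops from q + 2 to q and 4 q + 4 >= 12 |C|.\<close>

lemma card_tri_box_le:
  assumes "finite A" "finite B" "finite C"
  shows "6 * card (tri_box A B C) \<le> (card A + card B + card C)\<^sup>2"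
  using assms
proof (induction "card A + card B + card C" arbitrary: A B C rule: less_induct)
  case less
  note fin = less.prems
  have step: "6 * card (tri_box A' B' C') \<le> (card A' + card B' + card C')\<^sup>2"
    if small: "3 * card C' < card A' + card B' + card C'" "card C' \<le> card A'" "card C' \<le> card B'"
      and fin': "finite A'" "finite B'" "finite C'"
      and eq: "card A' + card B' + card C' = card A + card B + card C" for A' B' C'
  proof (cases "card C' = 0")
    case True
    then show ?thesis using fin' by (simp add: tri_box_def)
  next
    case False
    then have "A' \<noteq> {}" "B' \<noteq> {}" using small fin' by auto
    then obtain a b where ab: "a \<in> A'" "b \<in> B'"
      "card (tri_box A' B' C') \<le> card (tri_box (A' - {a}) (B' - {b}) C') + 2 * card C'"
      using card_tri_box_remove fin' by metis
    have c: "card A' = Suc (card (A' - {a}))" "card B' = Suc (card (B' - {b}))"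
      using ab fin' card_Suc_Diff1 by metis+
    have "6 * card (tri_box (A' - {a}) (B' - {b}) C') \<le>
        (card (A' - {a}) + card (B' - {b}) + card C')\<^sup>2"
      using c eq fin' by (intro less.hyps) auto
    moreover define q where "q = card (A' - {a}) + card (B' - {b}) + card C'"
    ultimately have 1: "6 * card (tri_box (A' - {a}) (B' - {b}) C') \<le> q\<^sup>2" by simp
    have 2: "card A' + card B' + card C' = q + 2" using c q_def by simp
    have "q\<^sup>2 + 12 * card C' \<le> q\<^sup>2 + 4 * q + 4"
      using small(1) unfolding 2 by linarith
    also have "\<dots> = (q + 2)\<^sup>2" by (simp add: power2_eq_square)
    finally show ?thesis unfolding 2 using ab(3) 1 by linarith
  qed
  show ?case
  proof (cases "card A = card B \<and> card B = card C")
    case False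
    then consider "3 * card C < card A + card B + card C" "card C \<le> card A" "card C \<le> card B"
      | "3 * card A < card A + card B + card C" "card A \<le> card B" "card A \<le> card C"
      | "3 * card B < card A + card B + card C" "card B \<le> card A" "card B \<le> card C"
      by linarith
    then show ?thesis
    proof cases
      case 1
      then show ?thesis using step[of C A B] fin by simp
    next
      case 2
      then show ?thesis using step[of A B C] fin card_tri_box_rot[of A B C]
        by (simp add: ac_simps)
    next
      case 3
      then show ?thesis using step[of B C A] fin card_tri_box_rot[of C A B]
        by (simp add: ac_simps)
    qed
  next
    case True
    then obtain c where c: "card A = c" "card B = c" "card C = c" by auto
    consider "c = 0" | "c = 1" | "c \<ge> 2" by linarith
    then show ?thesis
    proof cases
      case 1
      then show ?thesis using c fin by (simp add: tri_box_def)
    next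
      case 2
      have "card (tri_box A B C) \<le> card (A \<times> B \<times> C)"
        using fin by (intro card_mono) (auto simp: tri_box_def)
      then show ?thesis using c 2 by (simp add: card_cartesian_product power2_eq_square)
    next
      case 3
      \<comment> \<open>With equal counts c, one deletion falls just short. Three deletions,
        removing two rows in each direction, cost at most 2 c + 2 (c - 1) + 2 (c - 2) = 6 c - 6
        triangles, which is exactly (9 c^2 - 9 (c - 2)^2) / 6.\<close>
      obtain a b where 1: "a \<in> A" "b \<in> B"
        "card (tri_box A B C) \<le> card (tri_box (A - {a}) (B - {b}) C) + 2 * card C"
        using card_tri_box_remove[of A B C] fin c 3 by (metis card.empty not_numeral_le_zero)
      define A1 B1 where "A1 = A - {a}" and "B1 = B - {b}"
      have c1: "card A1 = c - 1" "card B1 = c - 1" "finite A1" "finite B1"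
        using 1 fin c by (auto simp: A1_def B1_def)
      then have "B1 \<noteq> {}" "C \<noteq> {}" using 3 c by auto
      then obtain b' z where 2: "b' \<in> B1" "z \<in> C"
        "card (tri_box B1 C A1) \<le> card (tri_box (B1 - {b'}) (C - {z}) A1) + 2 * card A1"
        using card_tri_box_remove[of B1 C A1] fin c1 by metis
      define B2 C1 where "B2 = B1 - {b'}" and "C1 = C - {z}"
      have c2: "card B2 = c - 2" "card C1 = c - 1" "finite B2" "finite C1"
        using 2 fin c c1 by (auto simp: B2_def C1_def)
      then have "A1 \<noteq> {}" "C1 \<noteq> {}" using 3 c1 by auto
      then obtain z' a' where 4: "z' \<in> C1" "a' \<in> A1"
        "card (tri_box C1 A1 B2) \<le> card (tri_box (C1 - {z'}) (A1 - {a'}) B2) + 2 * card B2"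
        using card_tri_box_remove[of C1 A1 B2] c1 c2 by metis
      define C2 A2 where "C2 = C1 - {z'}" and "A2 = A1 - {a'}"
      have c3: "card C2 = c - 2" "card A2 = c - 2" "finite C2" "finite A2"
        using 4 c1 c2 by (auto simp: A2_def C2_def)
      have "6 * card (tri_box C2 A2 B2) \<le> (card C2 + card A2 + card B2)\<^sup>2"
        using c3 c2 c 3 by (intro less.hyps) auto
      moreover obtain d where d: "c = d + 2" using 3 by (metis le_add_diff_inverse2)
      moreover have "card (tri_box A B C) \<le> card (tri_box C2 A2 B2) + 2 * c + 2 * (c - 1) + 2 * (c - 2)"
        using 1(3) 2(3) 4(3) card_tri_box_rot[of A1 B1 C] card_tri_box_rot[of C1 A1 B2]
          card_tri_box_rot[of A1 B2 C1] c c1 c2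
        unfolding A1_def[symmetric] B1_def[symmetric] B2_def[symmetric] C1_def[symmetric]
          A2_def[symmetric] C2_def[symmetric] by linarith
      ultimately show ?thesis
        using c c2 c3 by (simp add: power2_eq_square algebra_simps)
    qed
  qed
qed

lemma row_ends:
  fixes F :: "tri set"
  assumes "finite F" "F \<subseteq> tris"
  shows "2 * card (fst ` F) \<le> card {(t, t') \<in> bd F. fst t = fst t'}"
proof -
  \<comment> \<open>Along a fixed row, \<delta> grows by 1 from each triangle to the next, so the
    neighbour beyond an extremal member of the row lies outside \<open>F\<close>.\<close>
  define \<delta> :: "tri \<Rightarrow> int" where "\<delta> = (\<lambda>(i, j, l). j - l)"
  define E where "E s = {(t, t') \<in> bd F. fst t = fst t' \<and> \<delta> t' = \<delta> t + s}" for s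
  have finE: "finite (E s)" for s
    using finite_subset[of "E s" "bd F"] assms(1) by (auto simp: E_def)
  have card_E: "card (fst ` F) \<le> card (E s)" if s: "s = 1 \<or> s = -1" for s
  proof (rule surj_card_le[OF finE, where f = "fst \<circ> fst"], rule subsetI)
    fix i assume i: "i \<in> fst ` F"
    define G where "G = {t \<in> F. fst t = i}"
    have "finite G" "G \<noteq> {}" using i assms unfolding G_def by fastforce+
    then obtain t where t: "t \<in> G" and max: "\<And>u. u \<in> G \<Longrightarrow> s * \<delta> u \<le> s * \<delta> t"
      using ex_is_arg_min_if_finite[of G "\<lambda>u. - (s * \<delta> u)"] by (auto simp: is_arg_min_linorder)
    obtain j l where jl: "t = (i, j, l)" using t by (cases t) (auto simp: G_def)
    have "i + j + l = 0 \<or> i + j + l = -1" using t assms(2) by (auto simp: G_def jl tris_def)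
    then obtain t' where t': "adj t t'" "fst t' = i" "\<delta> t' = \<delta> t + s"
    proof (elim disjE)
      assume *: "i + j + l = 0"
      show ?thesis
      proof (cases "s = 1")
        case True
        show ?thesis by (rule that[of "(i, j, l - 1)"]) (use * True in \<open>auto simp: jl \<delta>_def tris_def adj.simps\<close>)
      next
        case False
        show ?thesis by (rule that[of "(i, j - 1, l)"]) (use * s False in \<open>auto simp: jl \<delta>_def tris_def adj.simps\<close>)
      qed
    next
      assume *: "i + j + l = -1"
      show ?thesis
      proof (cases "s = 1")
        case True
        show ?thesis by (rule that[of "(i, j + 1, l)"]) (use * True in \<open>auto simp: jl \<delta>_def tris_def adj.simps\<close>)
      next
        case False
        show ?thesis by (rule that[of "(i, j, l + 1)"]) (use * s False in \<open>auto simp: jl \<delta>_def tris_def adj.simps\<close>)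
      qed
    qed
    have "s * \<delta> t < s * \<delta> t'" using t'(3) s by auto
    then have "t' \<notin> G" using max[of t'] by linarith
    then have "(t, t') \<in> E s" using t t' by (auto simp: E_def G_def bd_def)
    then show "i \<in> (fst \<circ> fst) ` E s" using jl by (intro image_eqI[of _ _ "(t, t')"]) auto
  qed
  have "2 * card (fst ` F) \<le> card (E 1) + card (E (- 1))"
    using card_E[of 1] card_E[of "-1"] by simp
  also have "\<dots> = card (E 1 \<union> E (- 1))"
    by (rule card_Un_disjoint[OF finE finE, symmetric]) (auto simp: E_def)
  also have "\<dots> \<le> card {(t, t') \<in> bd F. fst t = fst t'}"
  proof (rule card_mono)
    show "finite {(t, t') \<in> bd F. fst t = fst t'}"
      by (rule finite_subset[OF _ finite_bd[OF assms(1)]]) blast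
  qed (auto simp: E_def)
  finally show ?thesis .
qed

lemma bd_rot: "bd (rot ` F) = map_prod rot rot ` bd F"
proof (intro equalityI subsetI)
  fix p assume "p \<in> bd (rot ` F)"
  then obtain t u where p: "p = (rot t, u)" "t \<in> F" "u \<notin> rot ` F" "adj (rot t) u"
    by (auto simp: bd_def)
  obtain j l i where "u = rot (i, j, l)" by (cases u) simp
  then show "p \<in> map_prod rot rot ` bd F"
    using p by (intro image_eqI[of _ _ "(t, (i, j, l))"]) (auto simp: bd_def simp del: rot.simps)
next
  fix p assume "p \<in> map_prod rot rot ` bd F"
  then obtain t u where "p = (rot t, rot u)" "t \<in> F" "u \<notin> F" "adj t u"
    by (auto simp: bd_def)
  then show "p \<in> bd (rot ` F)"
    using inj_rot by (auto simp: bd_def inj_image_mem_iff)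
qed

lemma card_bd_rot:
  "card {(t, t') \<in> bd (rot ` F). P t t'} = card {(t, t') \<in> bd F. P (rot t) (rot t')}"
proof -
  have "{p \<in> map_prod rot rot ` bd F. case_prod P p}
      = map_prod rot rot ` {p \<in> bd F. case_prod P (map_prod rot rot p)}"
    by (rule Compr_image_eq)
  then have "{(t, t') \<in> bd (rot ` F). P t t'} = map_prod rot rot ` {(t, t') \<in> bd F. P (rot t) (rot t')}"
    unfolding bd_rot by (simp add: case_prod_unfold)
  moreover have inj: "inj (map_prod rot rot)" using inj_rot by (simp add: prod.inj_map)
  ultimately show ?thesis by (simp only: card_image[OF inj_on_subset[OF inj subset_UNIV]])
qed

lemma row_ends_rot:
  fixes F :: "tri set"
  assumes "finite F" "F \<subseteq> tris"
  shows "2 * card ((fst \<circ> snd) ` F) \<le> card {(t, t') \<in> bd F. fst (snd t) = fst (snd t')}"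
    and "2 * card ((snd \<circ> snd) ` F) \<le> card {(t, t') \<in> bd F. snd (snd t) = snd (snd t')}"
proof -
  have fst_rot: "fst (rot t) = fst (snd t)" "fst (snd (rot t)) = snd (snd t)" for t
    by (cases t; simp)+
  have sub: "rot ` F \<subseteq> tris" "rot ` rot ` F \<subseteq> tris" using assms(2) by (auto simp: tris_rot)
  show "2 * card ((fst \<circ> snd) ` F) \<le> card {(t, t') \<in> bd F. fst (snd t) = fst (snd t')}"
    using row_ends[OF finite_imageI[OF assms(1)] sub(1)]
    unfolding card_bd_rot by (simp only: fst_rot image_image comp_def)
  show "2 * card ((snd \<circ> snd) ` F) \<le> card {(t, t') \<in> bd F. snd (snd t) = snd (snd t')}"
    using row_ends[OF finite_imageI[OF finite_imageI[OF assms(1)]] sub(2)]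
    unfolding card_bd_rot by (simp only: fst_rot image_image comp_def)
qed

text \<open>A boundary edge joins two triangles that share two of their three rows, and every
  nonempty row has an end on either side.\<close>

lemma isoperimetric:
  fixes F :: "tri set"
  assumes "finite F" "F \<subseteq> tris"
  shows "6 * card F \<le> (card (bd F))\<^sup>2"
proof -
  define E1 where "E1 = {(t, t') \<in> bd F. fst t \<noteq> fst t'}"
  define E2 where "E2 = {(t, t') \<in> bd F. fst (snd t) \<noteq> fst (snd t')}"
  define E3 where "E3 = {(t, t') \<in> bd F. snd (snd t) \<noteq> snd (snd t')}"
  note E_defs = E1_def E2_def E3_def
  have fin: "finite E1" "finite E2" "finite E3"
    unfolding E_defs by (rule finite_subset[OF _ finite_bd[OF assms(1)]]; blast)+
  have one: "(fst t \<noteq> fst t' \<and> fst (snd t) = fst (snd t') \<and> snd (snd t) = snd (snd t')) \<or>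
      (fst t = fst t' \<and> fst (snd t) \<noteq> fst (snd t') \<and> snd (snd t) = snd (snd t')) \<or>
      (fst t = fst t' \<and> fst (snd t) = fst (snd t') \<and> snd (snd t) \<noteq> snd (snd t'))"
    if "(t, t') \<in> bd F" for t t'
    using that by (cases t; cases t') (simp add: bd_def adj.simps)
  have disj: "E1 \<inter> E2 = {}" "E1 \<inter> E3 = {}" "E2 \<inter> E3 = {}"
    unfolding E_defs using one by blast+
  have eqs: "bd F = E1 \<union> E2 \<union> E3" "{(t, t') \<in> bd F. fst t = fst t'} = E2 \<union> E3"
    "{(t, t') \<in> bd F. fst (snd t) = fst (snd t')} = E1 \<union> E3"
    "{(t, t') \<in> bd F. snd (snd t) = snd (snd t')} = E1 \<union> E2"
    unfolding E_defs using one by blast+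
  have "card (bd F) = card E1 + card E2 + card E3"
    unfolding eqs(1) using fin disj by (simp add: card_Un_disjoint Int_Un_distrib2)
  then have perimeter: "card (fst ` F) + card ((fst \<circ> snd) ` F) + card ((snd \<circ> snd) ` F) \<le> card (bd F)"
    using row_ends[OF assms] row_ends_rot[OF assms] fin disj
    unfolding eqs(2-4) by (simp add: card_Un_disjoint)
  have "F \<subseteq> tri_box (fst ` F) ((fst \<circ> snd) ` F) ((snd \<circ> snd) ` F)"
    using assms(2) by (force simp: tri_box_def)
  then have "card F \<le> card (tri_box (fst ` F) ((fst \<circ> snd) ` F) ((snd \<circ> snd) ` F))"
    using assms(1) by (intro card_mono) auto
  then have "6 * card F \<le> (card (fst ` F) + card ((fst \<circ> snd) ` F) + card ((snd \<circ> snd) ` F))\<^sup>2"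
    using card_tri_box_le[of "fst ` F" "(fst \<circ> snd) ` F" "(snd \<circ> snd) ` F"] assms(1) by simp
  also have "\<dots> \<le> (card (bd F))\<^sup>2"
    using perimeter by (rule power_mono) simp
  finally show ?thesis .
qed

section \<open>Boundary edges in the presence of holes\<close>

text \<open>The members of \<S> are the tile sets of holes; by \<open>closed\<close> all their
  boundary edges face \<open>I\<close>. The boundary of \<open>I\<close> therefore contains,
  disjointly, the boundaries of all holes and that of the filled set \<open>F\<close>, whose length
  is \<open>p\<close>.\<close>

lemma edge_connected_with_holes:
  fixes I :: "tri set"
  assumes I: "finite I" "I \<noteq> {}" "I \<subseteq> tris" "edge_connected I"
    and fin: "finite \<S>" "\<And>S. S \<in> \<S> \<Longrightarrow> finite S"
    and S: "\<And>S. S \<in> \<S> \<Longrightarrow> S \<noteq> {}" "\<And>S. S \<in> \<S> \<Longrightarrow> S \<subseteq> tris - I"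
    and disj: "\<And>S S'. S \<in> \<S> \<Longrightarrow> S' \<in> \<S> \<Longrightarrow> S \<noteq> S' \<Longrightarrow> S \<inter> S' = {}"
    and closed: "\<And>S t t'. S \<in> \<S> \<Longrightarrow> t \<in> S \<Longrightarrow> adj t t' \<Longrightarrow> t' \<in> S \<union> I"
  obtains p where "3 * card \<S> + p \<le> card I + 2" "6 * (card I + card \<S>) \<le> p\<^sup>2"
proof -
  define F where "F = I \<union> \<Union>\<S>"
  have finF: "finite F" "F \<subseteq> tris" using I S(2) fin by (auto simp: F_def)
  have "card \<S> = (\<Sum>S\<in>\<S>. 1)" by simp
  also have "\<dots> \<le> (\<Sum>S\<in>\<S>. card S)"
    using fin S(1) by (intro sum_mono) (simp add: Suc_le_eq card_gt_0_iff)
  also have "\<dots> = card (\<Union>\<S>)"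
    by (rule card_Union_disjoint[symmetric]) (use disj fin in \<open>auto simp: pairwise_def disjnt_def\<close>)
  finally have "card I + card \<S> \<le> card I + card (\<Union>\<S>)" by simp
  also have "\<dots> = card F"
    unfolding F_def by (rule card_Un_disjoint[symmetric]) (use I fin S(2) in auto)
  finally have "6 * (card I + card \<S>) \<le> (card (bd F))\<^sup>2"
    using isoperimetric[OF finF] by simp
  moreover have "3 * card \<S> + card (bd F) \<le> card I + 2"
  proof -
    \<comment> \<open>The isoperimetric inequality applies to the hole as well: its perimeter
      squared is at least 6.\<close>
    have three: "3 \<le> card (bd S)" if "S \<in> \<S>" for S
    proof (rule ccontr)
      assume "\<not> 3 \<le> card (bd S)"
      then have "(card (bd S))\<^sup>2 \<le> 2\<^sup>2" by (intro power_mono) auto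
      moreover have "0 < card S" using that fin S(1) by (simp add: card_gt_0_iff)
      ultimately show False using isoperimetric[of S] that fin S(2)[of S] by force
    qed
    have "3 * card \<S> = (\<Sum>S\<in>\<S>. 3)" by simp
    also have "\<dots> \<le> (\<Sum>S\<in>\<S>. card (prod.swap ` bd S))"
      using three by (intro sum_mono) (simp add: card_image)
    also have "\<dots> = card (\<Union>S\<in>\<S>. prod.swap ` bd S)"
    proof (rule card_UN_disjoint[symmetric])
      show "\<forall>S\<in>\<S>. finite (prod.swap ` bd S)" by (intro ballI finite_imageI finite_bd fin)
      \<comment> \<open>After swapping, the second component of an edge tells which hole it belongs
        to.\<close>
      have "snd p \<in> S" if "p \<in> prod.swap ` bd S" for S p using that by (auto simp: bd_def)
      then show "\<forall>S\<in>\<S>. \<forall>S'\<in>\<S>. S \<noteq> S' \<longrightarrow> prod.swap ` bd S \<inter> prod.swap ` bd S' = {}"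
        using disj by (metis disjoint_iff)
    qed (rule fin)
    finally have "3 * card \<S> + card (bd F) \<le> card (\<Union>S\<in>\<S>. prod.swap ` bd S) + card (bd F)"
      by simp
    also have "\<dots> = card ((\<Union>S\<in>\<S>. prod.swap ` bd S) \<union> bd F)"
    proof (rule card_Un_disjoint[symmetric])
      show "finite (\<Union>S\<in>\<S>. prod.swap ` bd S)" "finite (bd F)"
        by (intro finite_UN_I finite_imageI finite_bd fin finF; assumption)+
      have "snd p \<in> F" if "p \<in> (\<Union>S\<in>\<S>. prod.swap ` bd S)" for p
        using that by (auto simp: bd_def F_def)
      moreover have "snd p \<notin> F" if "p \<in> bd F" for p using that by (auto simp: bd_def)
      ultimately show "(\<Union>S\<in>\<S>. prod.swap ` bd S) \<inter> bd F = {}"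
        by (metis disjoint_iff)
    qed
    also have "\<dots> \<le> card (bd I)"
    proof (rule card_mono)
      have "prod.swap ` bd S \<subseteq> bd I" if "S \<in> \<S>" for S
      proof (rule image_subsetI)
        fix p assume "p \<in> bd S"
        then obtain t u where p: "p = (t, u)" "t \<in> S" "u \<notin> S" "adj t u" by (auto simp: bd_def)
        then have "u \<in> I" "t \<notin> I" "adj u t"
          using closed[OF that p(2,4)] S(2)[OF that] adj_sym by blast+
        then show "prod.swap p \<in> bd I" by (simp add: p bd_def)
      qed
      moreover have "bd F \<subseteq> bd I"
      proof
        fix p assume "p \<in> bd F"
        then obtain t u where p: "p = (t, u)" "t \<in> F" "u \<notin> F" "adj t u" by (auto simp: bd_def)
        then have "t \<in> I" using closed unfolding F_def by blast
        then show "p \<in> bd I" using p by (simp add: bd_def F_def)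
      qed
      ultimately show "(\<Union>S\<in>\<S>. prod.swap ` bd S) \<union> bd F \<subseteq> bd I" by blast
    qed (use I in simp)
    also have "\<dots> \<le> card I + 2" using edge_connected_card_bd I by blast
    finally show ?thesis .
  qed
  ultimately show ?thesis using that by blast
qed

section \<open>Triangles in the plane\<close>

text \<open>\<open>X\<close> and \<open>Y\<close> are the coordinates with respect to the lattice basis \<open>1\<close>, \<open>omega\<close>. The
  normalisation \<open>X + Y + W = 1\<close> makes the triangle around \<open>(1/3, 1/3, 1/3)\<close> have index \<open>(0, 0, 0)\<close>.\<close>

definition X :: "complex \<Rightarrow> real" where "X z = Re z - Im z / sqrt 3"
definition Y :: "complex \<Rightarrow> real" where "Y z = 2 * Im z / sqrt 3"
definition W :: "complex \<Rightarrow> real" where "W z = 1 - X z - Y z"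

lemma linear_X: "linear X" and linear_Y: "linear Y"
  by (auto intro!: linearI simp: X_def Y_def field_simps)

lemmas XY_simps = linear_add[OF linear_X] linear_add[OF linear_Y]
  linear_diff[OF linear_X] linear_diff[OF linear_Y]
  linear_scale[OF linear_X] linear_scale[OF linear_Y]

lemma continuous_XYW: "continuous_on UNIV X" "continuous_on UNIV Y" "continuous_on UNIV W"
proof -
  show "continuous_on UNIV X" "continuous_on UNIV Y"
    using linear_X linear_Y linear_continuous_on linear_conv_bounded_linear by blast+
  then show "continuous_on UNIV W" unfolding W_def by (intro continuous_intros)
qed

lemma XY_eqI: "X z = X z' \<Longrightarrow> Y z = Y z' \<Longrightarrow> z = z'"
  by (auto simp: X_def Y_def complex_eq_iff)

lemma omega_eq: "omega = Complex (1/2) (sqrt 3 / 2)"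
  by (simp add: omega_def complex_eq_iff cos_60 sin_60)

lemma XY_omega: "X (of_real x + of_real y * omega) = x" "Y (of_real x + of_real y * omega) = y"
  by (simp_all add: X_def Y_def omega_eq field_simps)

lemma XY_lattice_pt: "X (lattice_pt a b) = of_int a" "Y (lattice_pt a b) = of_int b"
  using XY_omega[of "of_int a" "of_int b"] by (simp_all add: lattice_pt_def)

definition cell :: "tri \<Rightarrow> complex set" where
  "cell = (\<lambda>(i, j, l). {z. X z \<in> {of_int i..of_int i + 1} \<and> Y z \<in> {of_int j..of_int j + 1}
     \<and> W z \<in> {of_int l..of_int l + 1}})"

text \<open>For \<open>t = t'\<close> this is the interior of the triangle, for adjacent \<open>t\<close> and \<open>t'\<close> the interior of
  their union.\<close>

definition rhombus :: "tri \<Rightarrow> tri \<Rightarrow> complex set" where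
  "rhombus = (\<lambda>(i, j, l) (i', j', l'). {z. (i = i' \<longrightarrow> X z \<in> {of_int i<..<of_int i + 1})
     \<and> (j = j' \<longrightarrow> Y z \<in> {of_int j<..<of_int j + 1})
     \<and> (l = l' \<longrightarrow> W z \<in> {of_int l<..<of_int l + 1})})"

abbreviation ocell :: "tri \<Rightarrow> complex set" where "ocell t \<equiv> rhombus t t"

lemma in_cell: "z \<in> cell (i, j, l) \<longleftrightarrow> of_int i \<le> X z \<and> X z \<le> of_int i + 1 \<and>
    of_int j \<le> Y z \<and> Y z \<le> of_int j + 1 \<and> of_int l \<le> W z \<and> W z \<le> of_int l + 1"
  by (auto simp: cell_def)

lemma in_rhombus: "z \<in> rhombus (i, j, l) (i', j', l') \<longleftrightarrow>
    (i = i' \<longrightarrow> of_int i < X z \<and> X z < of_int i + 1) \<and>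
    (j = j' \<longrightarrow> of_int j < Y z \<and> Y z < of_int j + 1) \<and>
    (l = l' \<longrightarrow> of_int l < W z \<and> W z < of_int l + 1)"
  by (auto simp: rhombus_def)

text \<open>The excess of \<open>X\<close>, \<open>Y\<close>, \<open>W\<close> over the lower ends
  of their rows gives the barycentric coordinates.\<close>

lemma up_tile_cell: "up_tile a b = cell (a, b, - a - b)"
proof (intro equalityI subsetI)
  fix z assume "z \<in> up_tile a b"
  then obtain u v w where "0 \<le> u" "0 \<le> v" "0 \<le> w" "u + v + w = 1" and
    z: "z = u *\<^sub>R lattice_pt a b + v *\<^sub>R lattice_pt (a+1) b + w *\<^sub>R lattice_pt a (b+1)"
    by (auto simp: up_tile_def convex_hull_3)
  moreover from this have u: "u = 1 - v - w" by simp
  moreover have "X z = of_int a + v" "Y z = of_int b + w"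
    unfolding z u by (simp_all add: XY_simps XY_lattice_pt algebra_simps)
  ultimately show "z \<in> cell (a, b, - a - b)" by (simp add: in_cell W_def)
next
  fix z assume z: "z \<in> cell (a, b, - a - b)"
  define v w where "v = X z - of_int a" and "w = Y z - of_int b"
  have "z = (1 - v - w) *\<^sub>R lattice_pt a b + v *\<^sub>R lattice_pt (a+1) b + w *\<^sub>R lattice_pt a (b+1)"
    by (rule XY_eqI) (simp_all add: XY_simps XY_lattice_pt v_def w_def algebra_simps)
  moreover have "0 \<le> 1 - v - w" "0 \<le> v" "0 \<le> w" "(1 - v - w) + v + w = 1"
    using z by (simp_all add: in_cell v_def w_def W_def)
  ultimately show "z \<in> up_tile a b" unfolding up_tile_def convex_hull_3 by blast
qed

text \<open>For a down tile the barycentric coordinates are the distances to the upper ends of the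
  rows.\<close>

lemma down_tile_cell: "down_tile a b = cell (a, b, - a - b - 1)"
proof (intro equalityI subsetI)
  fix z assume "z \<in> down_tile a b"
  then obtain u v w where "0 \<le> u" "0 \<le> v" "0 \<le> w" "u + v + w = 1" and
    z: "z = u *\<^sub>R lattice_pt (a+1) b + v *\<^sub>R lattice_pt a (b+1) + w *\<^sub>R lattice_pt (a+1) (b+1)"
    by (auto simp: down_tile_def convex_hull_3)
  moreover from this have w: "w = 1 - u - v" by simp
  moreover have "X z = of_int a + 1 - v" "Y z = of_int b + 1 - u"
    unfolding z w by (simp_all add: XY_simps XY_lattice_pt algebra_simps)
  ultimately show "z \<in> cell (a, b, - a - b - 1)" by (simp add: in_cell W_def)
next
  fix z assume z: "z \<in> cell (a, b, - a - b - 1)"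
  define u v where "u = of_int b + 1 - Y z" and "v = of_int a + 1 - X z"
  have "z = u *\<^sub>R lattice_pt (a+1) b + v *\<^sub>R lattice_pt a (b+1) + (1 - u - v) *\<^sub>R lattice_pt (a+1) (b+1)"
    by (rule XY_eqI) (simp_all add: XY_simps XY_lattice_pt u_def v_def algebra_simps)
  moreover have "0 \<le> u" "0 \<le> v" "0 \<le> 1 - u - v" "u + v + (1 - u - v) = 1"
    using z by (simp_all add: in_cell u_def v_def W_def)
  ultimately show "z \<in> down_tile a b" unfolding down_tile_def convex_hull_3 by blast
qed

lemma tiles_eq: "tiles = cell ` tris"
proof (intro equalityI subsetI)
  fix S assume "S \<in> tiles"
  then obtain a b where "S = up_tile a b \<or> S = down_tile a b" by (auto simp: tiles_def)
  moreover have "(a, b, - a - b) \<in> tris" "(a, b, - a - b - 1) \<in> tris" by (auto simp: tris_def)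
  ultimately show "S \<in> cell ` tris" unfolding up_tile_cell down_tile_cell by blast
next
  fix S assume "S \<in> cell ` tris"
  then obtain i j l where S: "S = cell (i, j, l)" and "i + j + l = 0 \<or> i + j + l = -1"
    by (auto simp: tris_def)
  then have "l = - i - j \<or> l = - i - j - 1" by auto
  then have "S = up_tile i j \<or> S = down_tile i j" using S by (auto simp: up_tile_cell down_tile_cell)
  then show "S \<in> tiles" by (auto simp: tiles_def)
qed

lemma compact_cell: "t \<in> tris \<Longrightarrow> compact (cell t)"
proof -
  assume "t \<in> tris"
  then have "cell t \<in> tiles" by (simp add: tiles_eq)
  then show ?thesis
    by (auto simp: tiles_def up_tile_def down_tile_def intro!: finite_imp_compact_convex_hull)
qed

lemma open_rhombus: "open (rhombus t t')"
proof -
  obtain i j l i' j' l' where t: "t = (i, j, l)" "t' = (i', j', l')" by (metis prod_cases3)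
  have "open {z. P \<longrightarrow> f z \<in> {a<..<b}}" if "continuous_on UNIV f"
    for P :: bool and f :: "complex \<Rightarrow> real" and a b
    using open_vimage[OF open_greaterThanLessThan that] by (cases P) (auto simp: vimage_def)
  then show ?thesis
    unfolding t rhombus_def prod.case by (intro open_Collect_conj) (use continuous_XYW in blast)+
qed

lemma convex_rhombus: "convex (rhombus t t')"
proof -
  obtain i j l i' j' l' where t: "t = (i, j, l)" "t' = (i', j', l')" by (metis prod_cases3)
  have *: "convex {z. P \<longrightarrow> f z \<in> S}" if "linear f" "convex S"
    for P :: bool and f :: "complex \<Rightarrow> real" and S
    using convex_linear_vimage[OF that] by (cases P) (auto simp: vimage_def)
  \<comment> \<open>\<open>W\<close> is affine but not linear; through \<open>X + Y\<close> its
    condition becomes the preimage of an interval under a linear map.\<close>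
  have W: "{z. P \<longrightarrow> W z \<in> {of_int l<..<of_int l + 1}} =
      {z. P \<longrightarrow> X z + Y z \<in> {- of_int l<..<1 - of_int l}}" for P l by (auto simp: W_def)
  have "rhombus t t' = {z. i = i' \<longrightarrow> X z \<in> {of_int i<..<of_int i + 1}} \<inter>
      {z. j = j' \<longrightarrow> Y z \<in> {of_int j<..<of_int j + 1}} \<inter>
      {z. l = l' \<longrightarrow> W z \<in> {of_int l<..<of_int l + 1}}"
    by (auto simp: t rhombus_def)
  then show ?thesis
    unfolding W by (simp only:) (intro convex_Int * linear_compose_add linear_X linear_Y convex_real_interval)
qed

lemma ocell_subset_cell: "ocell t \<subseteq> cell t"
  by (cases t) (auto simp: in_rhombus in_cell)

lemma ocell_subset_rhombus: "ocell t \<subseteq> rhombus t t'" "ocell t \<subseteq> rhombus t' t"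
  by (cases t; cases t'; auto simp: in_rhombus)+

lemma ocell_nonempty: "t \<in> tris \<Longrightarrow> ocell t \<noteq> {}"
proof -
  assume "t \<in> tris"
  then obtain i j l where t: "t = (i, j, l)" and "i + j + l = 0 \<or> i + j + l = -1"
    by (auto simp: tris_def)
  then have l: "l = - i - j \<or> l = - i - j - 1" by linarith
  \<comment> \<open>At the centroid all three coordinates have fractional part 1/3 in an up tile and
    2/3 in a down tile.\<close>
  define \<theta> :: real where "\<theta> = (if l = - i - j then 1/3 else 2/3)"
  define c where "c = of_real (of_int i + \<theta>) + of_real (of_int j + \<theta>) * omega"
  have "X c = of_int i + \<theta>" "Y c = of_int j + \<theta>" unfolding c_def XY_omega by auto
  then have "c \<in> ocell t" using l by (auto simp: t in_rhombus W_def \<theta>_def)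
  then show ?thesis by blast
qed

text \<open>Move a point of the tile slightly towards an inner point \<open>c\<close>: the result
  lies in the open tile and converges to the given point.\<close>

lemma cell_subset_closure_ocell: 
  assumes "t \<in> tris"
  shows "cell t \<subseteq> closure (ocell t)"
proof
  fix z assume z: "z \<in> cell t"
  obtain c where c: "c \<in> ocell t" using ocell_nonempty[OF assms] by blast
  obtain i j l where t: "t = (i, j, l)" by (cases t)
  define e :: "nat \<Rightarrow> real" where "e n = inverse (real (Suc (Suc n)))" for n
  have e: "0 < e n" "e n < 1" for n by (auto simp: e_def field_simps)
  have comb: "a < (1 - e n) * x + e n * y \<and> (1 - e n) * x + e n * y < a + 1"
    if "a \<le> x" "x \<le> a + 1" "a < y" "y < a + 1" for a x y n
  proof -
    have "0 \<le> (1 - e n) * (x - a)" "0 < e n * (y - a)" "0 \<le> (1 - e n) * (a + 1 - x)" "0 < e n * (a + 1 - y)"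
      using e[of n] that by auto
    then show ?thesis by (auto simp: algebra_simps)
  qed
  define f where "f n = (1 - e n) *\<^sub>R z + e n *\<^sub>R c" for n
  have XYf: "X (f n) = (1 - e n) * X z + e n * X c" "Y (f n) = (1 - e n) * Y z + e n * Y c" for n
    by (simp_all add: f_def XY_simps)
  then have Wf: "W (f n) = (1 - e n) * W z + e n * W c" for n
    by (simp add: W_def algebra_simps)
  have "f n \<in> ocell t" for n
    using z c comb unfolding t in_cell in_rhombus XYf Wf by auto
  moreover have "e \<longlonglongrightarrow> 0" unfolding e_def
    using LIMSEQ_Suc[OF LIMSEQ_inverse_real_of_nat] by simp
  then have "f \<longlonglongrightarrow> (1 - 0) *\<^sub>R z + 0 *\<^sub>R c" unfolding f_def by (intro tendsto_intros)
  ultimately show "z \<in> closure (ocell t)" unfolding closure_sequential by auto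
qed

lemma row_unique:
  fixes x :: real
  assumes "of_int i < x" "x < of_int i + 1" "of_int a \<le> x" "x \<le> of_int a + 1"
  shows "a = i"
  using assms by linarith

text \<open>Rows common to \<open>t\<close> and \<open>t'\<close> contain \<open>z\<close> strictly,
  which fixes these rows of \<open>u\<close>. As the index sum is 0 or -1, at most two values remain
  for the last coordinate.\<close>

lemma cell_meets_rhombus:
  assumes "adj t t' \<or> t = t'" "t \<in> tris" "u \<in> tris" "z \<in> rhombus t t'" "z \<in> cell u"
  shows "u = t \<or> u = t'"
proof -
  obtain i j l i' j' l' a b c where t: "t = (i, j, l)" "t' = (i', j', l')" "u = (a, b, c)"
    by (metis prod_cases3)
  have "i = i' \<longrightarrow> a = i" "j = j' \<longrightarrow> b = j" "l = l' \<longrightarrow> c = l"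
    using assms(4,5) unfolding t in_rhombus in_cell by (blast intro: row_unique)+
  then show ?thesis using assms(1-3) unfolding t by (auto simp: adj.simps tris_def)
qed

lemma rhombus_subset_cells:
  assumes "adj t t'"
  shows "rhombus t t' \<subseteq> cell t \<union> cell t'"
proof
  fix z assume z: "z \<in> rhombus t t'"
  obtain i j l i' j' l' where t: "t = (i, j, l)" "t' = (i', j', l')"
    by (metis prod_cases3)
  have sums: "i + j + l = 0 \<and> i' + j' + l' = -1 \<or> i + j + l = -1 \<and> i' + j' + l' = 0"
    using assms unfolding t by (auto simp: adj.simps tris_def)
  then have "real_of_int i + j + l = 0 \<and> real_of_int i' + j' + l' = -1 \<or>
      real_of_int i + j + l = -1 \<and> real_of_int i' + j' + l' = 0"
    by (metis of_int_0 of_int_1 of_int_add of_int_minus)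
  moreover have "X z + Y z + W z = 1" by (simp add: W_def)
  moreover have "i \<noteq> i' \<and> j = j' \<and> l = l' \<or> i = i' \<and> j \<noteq> j' \<and> l = l' \<or> i = i' \<and> j = j' \<and> l \<noteq> l'"
    using assms unfolding t by (simp add: adj.simps)
  ultimately show "z \<in> cell t \<union> cell t'"
    using z unfolding t in_rhombus Un_iff in_cell by (elim disjE conjE) (simp_all, linarith+)
qed

lemma cell_cover: obtains t where "t \<in> tris" "z \<in> cell t"
proof -
  define i j where "i = \<lfloor>X z\<rfloor>" and "j = \<lfloor>Y z\<rfloor>"
  have ij: "of_int i \<le> X z" "X z < of_int i + 1" "of_int j \<le> Y z" "Y z < of_int j + 1"
    by (auto simp: i_def j_def)
  show ?thesis
  proof (cases "X z + Y z \<le> of_int i + of_int j + 1")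
    case True
    show ?thesis
      by (rule that[of "(i, j, - i - j)"]) (use ij True in \<open>auto simp: tris_def in_cell W_def\<close>)
  next
    case False
    show ?thesis
      by (rule that[of "(i, j, - i - j - 1)"]) (use ij False in \<open>auto simp: tris_def in_cell W_def\<close>)
  qed
qed

lemma inj_on_cell: "inj_on cell tris"
proof (rule inj_onI)
  fix t u assume *: "t \<in> tris" "u \<in> tris" "cell t = cell u"
  obtain z where "z \<in> ocell t" using ocell_nonempty *(1) by blast
  then show "t = u" using cell_meets_rhombus[of t t u z] ocell_subset_cell[of t] * by auto
qed

text \<open>Distinct tiles without a common edge lie in different rows for at least two directions.
  A point of two different closed rows has an integer coordinate there, and X + Y + W = 1 gives the
  third.\<close>

lemma cells_meet_in_lattice:
  assumes "t \<in> tris" "u \<in> tris" "t \<noteq> u" "\<not> adj t u" "z \<in> cell t" "z \<in> cell u"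
  shows "X z \<in> \<int>" "Y z \<in> \<int>"
proof -
  obtain i j l a b c where t: "t = (i, j, l)" "u = (a, b, c)" by (metis prod_cases3)
  have int: "x \<in> \<int>" if "of_int m \<le> x" "x \<le> of_int m + 1" "of_int n \<le> x" "x \<le> of_int n + 1" "m \<noteq> n"
    for x :: real and m n
  proof -
    have "x = of_int (max m n)" using that by linarith
    then show ?thesis by simp
  qed
  have "i \<noteq> a \<longrightarrow> X z \<in> \<int>" "j \<noteq> b \<longrightarrow> Y z \<in> \<int>" "l \<noteq> c \<longrightarrow> W z \<in> \<int>"
    using assms(5,6) unfolding t in_cell by (blast intro: int)+
  moreover have "i \<noteq> a \<and> j \<noteq> b \<or> i \<noteq> a \<and> l \<noteq> c \<or> j \<noteq> b \<and> l \<noteq> c"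
    using assms(1-4) unfolding t by (auto simp: adj.simps)
  moreover have "X z = 1 - W z - Y z" "Y z = 1 - W z - X z" by (auto simp: W_def)
  then have "Y z \<in> \<int> \<and> W z \<in> \<int> \<Longrightarrow> X z \<in> \<int>" "X z \<in> \<int> \<and> W z \<in> \<int> \<Longrightarrow> Y z \<in> \<int>"
    by (metis Ints_1 Ints_diff)+
  ultimately show "X z \<in> \<int>" "Y z \<in> \<int>" by blast+
qed

lemma not_Ints_ocell: "z \<in> ocell t \<Longrightarrow> X z \<notin> \<int>"
proof
  assume z: "z \<in> ocell t" "X z \<in> \<int>"
  obtain i j l where "t = (i, j, l)" by (cases t)
  moreover obtain n where "X z = of_int n" using z(2) by (auto elim: Ints_cases)
  ultimately show False using z(1) by (auto simp: in_rhombus)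
qed

section \<open>Holes and combinatorial components\<close>

lemma connected_rhombus: "connected (rhombus t t')"
  by (rule convex_connected[OF convex_rhombus])

lemma closed_cells:
  assumes "finite I" "I \<subseteq> tris"
  shows "closed (\<Union>(cell ` I))"
proof (rule closed_Union)
  show "\<forall>S\<in>cell ` I. closed S"
    using assms(2) compact_cell compact_imp_closed by blast
qed (use assms in simp)

lemma edge_connected_if_interior_connected:
  assumes I: "finite I" "I \<subseteq> tris" and conn: "connected (interior (\<Union>(cell ` I)))"
  shows "edge_connected I"
  unfolding edge_connected_def
proof (intro allI impI, rule ccontr)
  fix S assume S: "S \<noteq> {}" "S \<subset> I" and no: "\<not> (\<exists>s\<in>S. \<exists>t\<in>I - S. adj s t)"
  define P where "P = {z \<in> \<Union>(cell ` I). X z \<in> \<int> \<and> Y z \<in> \<int>}"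
  define U where "U = interior (\<Union>(cell ` I)) - P"
  define B where "B J = \<Union>(cell ` J)" for J
  \<comment> \<open>Removing finitely many points does not disconnect the open set, and cells without a common
    edge only meet in lattice points.\<close>
  have finP: "finite P"
  proof -
    have "{z \<in> cell t. X z \<in> \<int> \<and> Y z \<in> \<int>} \<subseteq>
        (\<lambda>(a, b). lattice_pt a b) ` ({fst t..fst t + 1} \<times> {fst (snd t)..fst (snd t) + 1})" for t
    proof
      fix z assume "z \<in> {z \<in> cell t. X z \<in> \<int> \<and> Y z \<in> \<int>}"
      then obtain a b where z: "z \<in> cell t" "X z = of_int a" "Y z = of_int b"
        by (auto elim!: Ints_cases)
      then have "z = lattice_pt a b" by (intro XY_eqI) (auto simp: XY_lattice_pt)
      moreover have "a \<in> {fst t..fst t + 1}" "b \<in> {fst (snd t)..fst (snd t) + 1}"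
        using z by (cases t; simp add: in_cell; linarith)+
      ultimately show "z \<in> (\<lambda>(a, b). lattice_pt a b) ` ({fst t..fst t + 1} \<times> {fst (snd t)..fst (snd t) + 1})"
        by blast
    qed
    then have "finite {z \<in> cell t. X z \<in> \<int> \<and> Y z \<in> \<int>}" for t
      by (rule finite_subset) auto
    moreover have "P = (\<Union>t\<in>I. {z \<in> cell t. X z \<in> \<int> \<and> Y z \<in> \<int>})" by (auto simp: P_def)
    ultimately show ?thesis using I(1) by simp
  qed
  have "connected U"
    unfolding U_def by (rule connected_open_delete_finite[OF open_interior conn _ finP]) simp
  moreover have "closed (B J)" if "J \<subseteq> I" for J
    unfolding B_def using that I finite_subset[OF that I(1)] by (intro closed_cells) auto
  then have "closed (B S)" "closed (B (I - S))" using S by auto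
  moreover have "U \<subseteq> B S \<union> B (I - S)"
    using interior_subset[of "\<Union>(cell ` I)"] by (auto simp: U_def B_def)
  moreover have "B S \<inter> B (I - S) \<inter> U = {}"
  proof (rule ccontr)
    assume "B S \<inter> B (I - S) \<inter> U \<noteq> {}"
    then obtain z s t where z: "z \<in> U" "s \<in> S" "t \<in> I - S" "z \<in> cell s" "z \<in> cell t"
      unfolding B_def by blast
    then have "X z \<in> \<int>" "Y z \<in> \<int>"
      using cells_meet_in_lattice[of s t z] no S(2) I(2) by blast+
    then have "z \<in> P" using z S(2) by (auto simp: P_def)
    then show False using z by (simp add: U_def)
  qed
  ultimately have "B S \<inter> U = {} \<or> B (I - S) \<inter> U = {}" using connected_closedD by blast
  \<comment> \<open>Both sides remain nonempty after the deletion, because open tiles contain no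
    lattice points.\<close>
  moreover have "B J \<inter> U \<noteq> {}" if J: "J \<noteq> {}" "J \<subseteq> I" for J
  proof -
    obtain t where t: "t \<in> J" using J by blast
    then obtain z where z: "z \<in> ocell t" using ocell_nonempty[of t] J I(2) by blast
    have "ocell t \<subseteq> interior (\<Union>(cell ` I))"
      using t J ocell_subset_cell[of t] by (intro interior_maximal open_rhombus) blast
    then have "z \<in> U" using z not_Ints_ocell by (auto simp: U_def P_def)
    moreover have "z \<in> B J" using z t ocell_subset_cell[of t] by (auto simp: B_def)
    ultimately show ?thesis by blast
  qed
  then have "B S \<inter> U \<noteq> {}" "B (I - S) \<inter> U \<noteq> {}" using S by auto
  ultimately show False by blast
qed

text \<open>Rhombi link the open tiles of adjacent triangles, so one component \<open>D\<close> of
  the interior contains every open tile. The interior lies between \<open>D\<close> and its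
  closure.\<close>

lemma interior_connected_if_edge_connected:
  assumes I: "finite I" "I \<subseteq> tris" and conn: "edge_connected I"
  shows "connected (interior (\<Union>(cell ` I)))"
proof (cases "I = {}")
  case False
  define U where "U = interior (\<Union>(cell ` I))"
  obtain t0 where t0: "t0 \<in> I" using False by blast
  obtain x0 where x0: "x0 \<in> ocell t0" using ocell_nonempty t0 I(2) by blast
  define D where "D = connected_component_set U x0"
  have sub: "ocell t \<subseteq> U" if "t \<in> I" for t
    unfolding U_def using that ocell_subset_cell[of t] by (intro interior_maximal open_rhombus) blast
  define K where "K = {t \<in> I. ocell t \<subseteq> D}"
  have "ocell t0 \<subseteq> D"
    unfolding D_def using x0 sub[OF t0] by (intro connected_component_maximal connected_rhombus)
  then have "K \<noteq> {}" using t0 unfolding K_def by blast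
  have "K = I"
  proof (rule ccontr)
    assume "K \<noteq> I"
    then have "K \<subset> I" by (auto simp: K_def)
    then obtain s t where st: "s \<in> K" "t \<in> I - K" "adj s t"
      using conn \<open>K \<noteq> {}\<close> unfolding edge_connected_def by meson
    obtain z where z: "z \<in> ocell s" using ocell_nonempty st(3) adj_tris by blast
    have "rhombus s t \<subseteq> U"
      unfolding U_def using rhombus_subset_cells[OF st(3)] st
      by (intro interior_maximal open_rhombus) (auto simp: K_def)
    moreover have "z \<in> rhombus s t" using z ocell_subset_rhombus by blast
    ultimately have "rhombus s t \<subseteq> connected_component_set U z"
      by (intro connected_component_maximal connected_rhombus)
    moreover have "z \<in> D" using z st(1) by (auto simp: K_def)
    then have "connected_component_set U z = D"
      unfolding D_def by (metis connected_component_eq)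
    ultimately have "ocell t \<subseteq> D" using ocell_subset_rhombus by blast
    then show False using st(2) by (simp add: K_def)
  qed
  show ?thesis
  proof (rule connected_intermediate_closure)
    show "connected D" by (simp add: D_def)
    show "D \<subseteq> interior (\<Union>(cell ` I))" unfolding D_def U_def[symmetric] by (rule connected_component_subset)
    have "cell t \<subseteq> closure D" if "t \<in> I" for t
    proof -
      have "cell t \<subseteq> closure (ocell t)" using cell_subset_closure_ocell that I(2) by blast
      also have "\<dots> \<subseteq> closure D" using that \<open>K = I\<close> by (intro closure_mono) (auto simp: K_def)
      finally show ?thesis .
    qed
    then show "interior (\<Union>(cell ` I)) \<subseteq> closure D"
      using interior_subset[of "\<Union>(cell ` I)"] by blast
  qed
qed simp

lemma rhombus_disjoint_cells:
  assumes "adj t t' \<or> t = t'" "t \<in> tris - I" "t' \<in> tris - I" "I \<subseteq> tris"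
  shows "rhombus t t' \<subseteq> - \<Union>(cell ` I)"
  using assms cell_meets_rhombus[of t t'] by blast

text \<open>Stated for any finite family of holes, so that it can also show that there are only
  finitely many.\<close>

lemma holes_inequality:
  assumes T: "polyiamond_tiles T" and \<C>: "finite \<C>" "\<C> \<subseteq> {C \<in> components (- \<Union>T). bounded C}"
  obtains p where "3 * card \<C> + p \<le> card T + 2" "6 * (card T + card \<C>) \<le> p\<^sup>2"
proof -
  obtain I where "I \<subseteq> tris" "T = cell ` I"
    using T unfolding polyiamond_tiles_def tiles_eq by (metis subset_image_iff)
  note I = this
  have inj: "inj_on cell I" using inj_on_subset[OF inj_on_cell I(1)] .
  have finI: "finite I" "I \<noteq> {}" "card T = card I"
    using T I(2) inj finite_imageD[OF _ inj] by (auto simp: polyiamond_tiles_def card_image)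
  have conn: "edge_connected I"
    using edge_connected_if_interior_connected[OF finI(1) I(1)] T I(2) by (simp add: polyiamond_tiles_def)
  \<comment> \<open>The tile set of the hole \<open>C\<close>. Open tiles are used because
    \<open>C\<close> omits the edges it shares with the polyiamond.\<close>
  define S where "S C = {t \<in> tris. ocell t \<subseteq> C}" for C
  have comp: "C \<in> components (- \<Union>(cell ` I))" "bounded C" if "C \<in> \<C>" for C
    using that \<C> I(2) by auto
  have closedA: "closed (\<Union>(cell ` I))"
    using I finI by (intro closed_cells) auto
  have SD: "t \<in> tris" "ocell t \<subseteq> C" "ocell t \<noteq> {}" if "t \<in> S C" for t C
    using that ocell_nonempty by (simp_all add: S_def)
  have disj: "S C \<inter> S C' = {}" if "C \<in> \<C>" "C' \<in> \<C>" "C \<noteq> C'" for C C'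
  proof -
    have "C \<inter> C' = {}"
      using components_nonoverlap[OF comp(1)[OF that(1)] comp(1)[OF that(2)]] that(3) by simp
    then have False if "t \<in> S C" "t \<in> S C'" for t using SD[OF that(1)] SD(2)[OF that(2)] by blast
    then show ?thesis by blast
  qed
  \<comment> \<open>The open set \<open>C\<close> meets some closed tile, hence its dense open part.
    That part avoids the polyiamond and, being connected, lies in \<open>C\<close>.\<close>
  have ne: "S C \<noteq> {}" if C: "C \<in> \<C>" for C
  proof -
    have "open C" using comp(1)[OF C] closedA open_components by blast
    obtain z where z: "z \<in> C" using comp(1)[OF C] in_components_nonempty by blast
    obtain t where t: "t \<in> tris" "z \<in> cell t" by (rule cell_cover)
    have "C \<inter> ocell t \<noteq> {}"
      using open_Int_closure_eq_empty[OF \<open>open C\<close>, of "ocell t"] t z cell_subset_closure_ocell by blast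
    moreover have "t \<notin> I" using t z in_components_subset[OF comp(1)[OF C]] by blast
    then have "ocell t \<subseteq> - \<Union>(cell ` I)"
      using rhombus_disjoint_cells[of t t I] t I by blast
    ultimately have "ocell t \<subseteq> C"
      using components_maximal[OF comp(1)[OF C]] connected_rhombus by blast
    then show ?thesis using t unfolding S_def by blast
  qed
  have finS: "finite (S C)" if C: "C \<in> \<C>" for C
  proof -
    have "bounded (X ` C)" "bounded (Y ` C)" 
      using comp(2)[OF C] linear_X linear_Y bounded_linear_image linear_conv_bounded_linear by blast+
    then obtain a b where ab: "\<And>z. z \<in> C \<Longrightarrow> \<bar>X z\<bar> \<le> a" "\<And>z. z \<in> C \<Longrightarrow> \<bar>Y z\<bar> \<le> b"
      by (auto simp: bounded_iff)
    \<comment> \<open>The added 1 accounts for row indices, which may lie up to 1 below the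
      coordinate of a point in the row.\<close>
    define m where "m = \<lceil>max a b\<rceil> + 1"
    have "S C \<subseteq> {-m..m} \<times> {-m..m} \<times> {-2 * m - 1..2 * m}"
    proof
      fix t assume t: "t \<in> S C"
      obtain i j l where ijl: "t = (i, j, l)" by (cases t)
      obtain z where z: "z \<in> ocell t" "z \<in> C" using SD(2,3)[OF t] by blast
      have "real_of_int i \<le> a" "- a \<le> real_of_int i + 1" "real_of_int j \<le> b" "- b \<le> real_of_int j + 1"
        using z(1) ab[OF z(2)] unfolding ijl in_rhombus by (auto simp: abs_le_iff)
      then have "-m \<le> i" "i \<le> m" "-m \<le> j" "j \<le> m" unfolding m_def by linarith+
      moreover have "i + j + l = 0 \<or> i + j + l = -1" using SD(1)[OF t] by (simp add: ijl tris_def)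
      ultimately show "t \<in> {-m..m} \<times> {-m..m} \<times> {-2 * m - 1..2 * m}" unfolding ijl by auto
    qed
    then show ?thesis by (rule finite_subset) simp
  qed
  have inC: "t \<notin> I" if C: "C \<in> \<C>" and t: "t \<in> S C" for C t
  proof
    assume "t \<in> I"
    then have "ocell t \<inter> - \<Union>(cell ` I) = {}" using ocell_subset_cell[of t] by blast
    moreover have "ocell t \<subseteq> - \<Union>(cell ` I)"
      by (rule order.trans[OF SD(2)[OF t] in_components_subset[OF comp(1)[OF C]]])
    ultimately show False using SD(3)[OF t] by (simp only: inf.absorb1)
  qed
  have closed: "t' \<in> S C \<union> I" if C: "C \<in> \<C>" and t: "t \<in> S C" "adj t t'" for C t t'
  proof (cases "t' \<in> I")
    case False
    have tr: "t \<in> tris" "t' \<in> tris" using adj_tris t(2) by blast+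
    have "rhombus t t' \<subseteq> - \<Union>(cell ` I)"
      using rhombus_disjoint_cells[of t t' I] tr False inC[OF C t(1)] t(2) I(1) by blast
    moreover have "C \<inter> rhombus t t' \<noteq> {}"
      using SD(2,3)[OF t(1)] ocell_subset_rhombus(1)[of t t'] by blast
    ultimately have "rhombus t t' \<subseteq> C"
      using components_maximal[OF comp(1)[OF C]] connected_rhombus by blast
    then have "ocell t' \<subseteq> C" using ocell_subset_rhombus(2)[of t' t] by (rule order.trans[rotated])
    then show ?thesis using tr by (simp add: S_def)
  qed simp
  have inj_S: "inj_on S \<C>"
    using disj ne by (metis inf.idem inj_onI)
  obtain p where "3 * card (S ` \<C>) + p \<le> card I + 2" "6 * (card I + card (S ` \<C>)) \<le> p\<^sup>2"
  proof (rule edge_connected_with_holes[OF finI(1,2) I(1) conn, of "S ` \<C>"])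
    show "S' \<inter> S'' = {}" if "S' \<in> S ` \<C>" "S'' \<in> S ` \<C>" "S' \<noteq> S''" for S' S''
      using that disj by blast
    show "t' \<in> S' \<union> I" if "S' \<in> S ` \<C>" "t \<in> S'" "adj t t'" for S' t t'
      using that closed by blast
    show "S' \<subseteq> tris - I" if "S' \<in> S ` \<C>" for S'
      using that inC by (auto simp: S_def)
  qed (use \<C>(1) finS ne in auto)
  then show ?thesis using that card_image[OF inj_S] finI(3) by simp
qed

text \<open>The three neighbours cover the boundary of \<open>t\<close>, so a connected set that
  contains the open tile and avoids the polyiamond cannot leave it: it would be separated by
  \<open>ocell t\<close> and the complement of \<open>cell t\<close>.\<close>

lemma ocell_component:
  assumes "I \<subseteq> tris" "t \<in> tris - I" "\<And>t'. adj t t' \<Longrightarrow> t' \<in> I"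
  shows "ocell t \<in> components (- \<Union>(cell ` I))" "bounded (ocell t)"
proof -
  define A where "A = \<Union>(cell ` I)"
  show "bounded (ocell t)"
    using compact_imp_bounded[OF compact_cell] bounded_subset ocell_subset_cell assms(2) by blast
  obtain i j l where t: "t = (i, j, l)" by (cases t)
  have sum: "i + j + l = 0 \<or> i + j + l = -1" using assms(2) by (auto simp: t tris_def)
  have bdry: "cell t - ocell t \<subseteq> A"
  proof
    fix z assume z: "z \<in> cell t - ocell t"
    have XYW: "X z + Y z + W z = 1" by (simp add: W_def)
    obtain t' where "adj t t'" "z \<in> cell t'"
      using sum
    proof (elim disjE)
      assume s: "i + j + l = 0"
      then have "real_of_int i + j + l = 0" by (metis of_int_0 of_int_add)
      \<comment> \<open>If all three lower bounds were strict, the sum 1 would make the upper bounds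
        strict too and \<open>z\<close> would lie in the open tile. For down tiles the roles are
        exchanged.\<close>
      then have "X z = of_int i \<or> Y z = of_int j \<or> W z = of_int l"
        using z XYW unfolding t in_cell in_rhombus Diff_iff by auto
      then show ?thesis
        using that[of "(i - 1, j, l)"] that[of "(i, j - 1, l)"] that[of "(i, j, l - 1)"] z s
        unfolding t by (auto simp: adj.simps tris_def in_cell)
    next
      assume s: "i + j + l = -1"
      then have "real_of_int i + j + l = -1" by (metis of_int_1 of_int_add of_int_minus)
      then have "X z = of_int i + 1 \<or> Y z = of_int j + 1 \<or> W z = of_int l + 1"
        using z XYW unfolding t in_cell in_rhombus Diff_iff by auto
      then show ?thesis
        using that[of "(i + 1, j, l)"] that[of "(i, j + 1, l)"] that[of "(i, j, l + 1)"] z s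
        unfolding t by (auto simp: adj.simps tris_def in_cell)
    qed
    then show "z \<in> A" using assms(3) unfolding A_def by blast
  qed
  have sub: "ocell t \<subseteq> - A" unfolding A_def using rhombus_disjoint_cells assms by blast
  have "D = ocell t" if D: "D \<noteq> {}" "ocell t \<subseteq> D" "D \<subseteq> - A" "connected D" for D
  proof -
    have "open (ocell t)" "open (- cell t)"
      using open_rhombus compact_imp_closed[OF compact_cell] assms(2) open_Compl by blast+
    moreover have "ocell t \<inter> - cell t \<inter> D = {}" "D \<subseteq> ocell t \<union> - cell t"
      using ocell_subset_cell[of t] bdry D(3) by blast+
    ultimately have "ocell t \<inter> D = {} \<or> - cell t \<inter> D = {}" using connectedD[OF D(4)] by blast
    then show ?thesis
      using D(2) ocell_nonempty[of t] assms(2) \<open>D \<subseteq> ocell t \<union> - cell t\<close> by blast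
  qed
  then show "ocell t \<in> components (- \<Union>(cell ` I))"
    unfolding in_components_maximal A_def[symmetric]
    using ocell_nonempty[of t] assms(2) sub connected_rhombus by (intro conjI allI impI) simp_all
qed

section \<open>The perforated hexagons\<close>

lemma edge_connected_if_reachable:
  assumes c: "\<And>t. t \<in> F \<Longrightarrow> (t, c) \<in> {(a, b). a \<in> F \<and> b \<in> F \<and> adj a b}\<^sup>*"
  shows "edge_connected F"
  unfolding edge_connected_def
proof (intro allI impI, rule ccontr)
  fix S assume S: "S \<noteq> {}" "S \<subset> F" and no: "\<not> (\<exists>s\<in>S. \<exists>t\<in>F - S. adj s t)"
  have stay: "a \<in> S \<longleftrightarrow> b \<in> S" if "(a, b) \<in> {(a, b). a \<in> F \<and> b \<in> F \<and> adj a b}" for a b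
  proof -
    have "a \<in> F" "b \<in> F" "adj a b" "adj b a" using that adj_sym by blast+
    then show ?thesis using no by blast
  qed
  have "t \<in> S \<longleftrightarrow> c \<in> S" if "t \<in> F" for t
    using c[OF that] by (induction rule: converse_rtrancl_induct) (use stay in blast)+
  then show False using S by blast
qed

text \<open>Each direction has 2 k rows. The long sides, of length k + 1, are at the upper ends of
  the ranges, the short ones, of length k - 1, at the lower ends; k = 1 gives the triangle of side
  2.\<close>

definition hexagon :: "nat \<Rightarrow> tri set" where
  "hexagon k = tri_box {- int k..<int k} {- int k..<int k} {- int k..<int k}"

text \<open>In the ring around \<open>hexagon m\<close>, the triangles sharing an edge with \<open>hexagon m\<close> are
  \<open>(m, j, -m-j)\<close> for \<open>-m \<le> j \<le> 0\<close>, then \<open>(m-j, j, -m-1)\<close> for \<open>0 < j < m\<close>, and the two rotations of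
  this chain of length \<open>2 m\<close>. Every other one, with \<open>j\<close> even, is a hole.\<close>

definition sector_holes :: "tri set" where
  "sector_holes = {(i, j, l). 0 < i \<and> even j \<and>
     (i + j + l = 0 \<and> j \<le> 0 \<and> l \<le> 0 \<or> i + j + l = -1 \<and> 0 < j)}"

definition hole_tris :: "tri set" where
  "hole_tris = {t. t \<in> sector_holes \<or> rot t \<in> sector_holes \<or> rot (rot t) \<in> sector_holes}"

definition perforated :: "nat \<Rightarrow> tri set" where
  "perforated k = hexagon k - hole_tris"

lemma rot_rot_rot [simp]: "rot (rot (rot t)) = t"
  by (cases t) simp

lemma in_hexagon: "(i, j, l) \<in> hexagon k \<longleftrightarrow> (i + j + l = 0 \<or> i + j + l = -1) \<and>
    - int k \<le> i \<and> i < int k \<and> - int k \<le> j \<and> j < int k \<and> - int k \<le> l \<and> l < int k"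
  by (auto simp: hexagon_def tri_box_def tris_def)

lemma in_hole_tris: "(i, j, l) \<in> hole_tris \<longleftrightarrow>
    0 < i \<and> even j \<and> (i + j + l = 0 \<and> j \<le> 0 \<and> l \<le> 0 \<or> i + j + l = -1 \<and> 0 < j) \<or>
    0 < j \<and> even l \<and> (i + j + l = 0 \<and> l \<le> 0 \<and> i \<le> 0 \<or> i + j + l = -1 \<and> 0 < l) \<or>
    0 < l \<and> even i \<and> (i + j + l = 0 \<and> i \<le> 0 \<and> j \<le> 0 \<or> i + j + l = -1 \<and> 0 < i)"
proof -
  have "j + l + i = i + j + l" "l + i + j = i + j + l" by simp_all
  note sums = this
  show ?thesis
    unfolding hole_tris_def sector_holes_def mem_Collect_eq rot.simps prod.case sums ..
qed

lemma rot_hexagon: "rot t \<in> hexagon k \<longleftrightarrow> t \<in> hexagon k"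
  by (cases t) (auto simp: in_hexagon)

lemma rot_hole_tris: "rot t \<in> hole_tris \<longleftrightarrow> t \<in> hole_tris"
  unfolding hole_tris_def by (simp del: rot.simps) blast

lemma rot_perforated: "rot t \<in> perforated k \<longleftrightarrow> t \<in> perforated k"
  by (simp add: perforated_def rot_hexagon rot_hole_tris)

lemma hexagon_tris: "hexagon k \<subseteq> tris"
  by (auto simp: hexagon_def tri_box_def)

lemma finite_hexagon: "finite (hexagon k)"
  by (simp add: hexagon_def)

lemma adj_iff: "adj (i, j, l) t \<longleftrightarrow> (i + j + l = 0 \<and> t \<in> {(i - 1, j, l), (i, j - 1, l), (i, j, l - 1)}
    \<or> i + j + l = -1 \<and> t \<in> {(i + 1, j, l), (i, j + 1, l), (i, j, l + 1)})"
proof (cases "(i, j, l) \<in> tris")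
  case True
  then have "i + j + l = 0 \<or> i + j + l = -1" by (simp add: tris_def)
  moreover have "adj (i, j, l) t \<longleftrightarrow> t \<in> {t. adj (i, j, l) t}" by simp
  ultimately show ?thesis unfolding neighbours[OF True] by (elim disjE) simp_all
next
  case False
  then show ?thesis using adj_tris(1)[of "(i, j, l)" t] by (auto simp: tris_def)
qed

text \<open>Up holes have exactly one positive coordinate and down holes exactly two. Neighbours of
  an up hole lower a coordinate and those of a down hole raise one, so no two holes are adjacent.
  The sign conditions also keep holes off the rim of the hexagon.\<close>

lemma sector_hole_isolated:
  assumes "t \<in> sector_holes" "t \<in> hexagon k" "adj t t'"
  shows "t' \<in> perforated k"
proof -
  obtain i j l where t: "t = (i, j, l)" by (cases t)
  have i: "0 < i" "even j" using assms(1) by (auto simp: t sector_holes_def)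
  consider "i + j + l = 0" "j \<le> 0" "l \<le> 0" | "i + j + l = -1" "0 < j"
    using assms(1) by (auto simp: t sector_holes_def)
  then show ?thesis
  proof cases
    case 1
    then have "t' = (i - 1, j, l) \<or> t' = (i, j - 1, l) \<or> t' = (i, j, l - 1)"
      using assms(3) by (simp add: t adj_iff)
    then show ?thesis
      using 1 i assms(2) unfolding t perforated_def Diff_iff
      by (elim disjE) (simp_all add: in_hexagon in_hole_tris)
  next
    case 2
    then have "j \<ge> 2" using i by presburger
    have "t' = (i + 1, j, l) \<or> t' = (i, j + 1, l) \<or> t' = (i, j, l + 1)"
      using assms(3) 2 by (simp add: t adj_iff)
    then show ?thesis
      using 2 i \<open>j \<ge> 2\<close> assms(2) unfolding t perforated_def Diff_iff
      by (elim disjE) (simp_all add: in_hexagon in_hole_tris)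
  qed
qed

lemma hole_isolated:
  assumes "t \<in> hole_tris" "t \<in> hexagon k" "adj t t'"
  shows "t' \<in> perforated k"
proof -
  consider "t \<in> sector_holes" | "rot t \<in> sector_holes" | "rot (rot t) \<in> sector_holes"
    using assms(1) unfolding hole_tris_def by blast
  then show ?thesis
  proof cases
    case 1
    then show ?thesis using sector_hole_isolated assms by blast
  next
    case 2
    then have "rot t' \<in> perforated k"
      using sector_hole_isolated[of "rot t" k "rot t'"] assms rot_hexagon by simp
    then show ?thesis by (simp add: rot_perforated)
  next
    case 3
    then have "rot (rot t') \<in> perforated k"
      using sector_hole_isolated[of "rot (rot t)" k "rot (rot t')"] assms rot_hexagon by simp
    then show ?thesis by (simp add: rot_perforated)
  qed
qed

section \<open>Connectivity of the perforated hexagons, ring by ring\<close>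

text \<open>A third of the ring around \<open>hexagon m\<close>: the long side i = m, then the short
  side l = -m-1. On each side the triangles touching \<open>hexagon m\<close> come first, then the
  outer ones.\<close>

definition ring_sector :: "nat \<Rightarrow> tri set" where
  "ring_sector m = (\<lambda>j. (int m, j, - int m - j)) ` {- int m..0}
     \<union> (\<lambda>j. (int m, j, - int m - 1 - j)) ` {- int m - 1..0}
     \<union> (\<lambda>j. (int m - j, j, - int m - 1)) ` {1..int m - 1}
     \<union> (\<lambda>j. (int m + 1 - j, j, - int m - 1)) ` {1..int m}"

lemma in_ring_sector: "(i, j, l) \<in> ring_sector m \<longleftrightarrow>
    i = int m \<and> - int m \<le> j \<and> j \<le> 0 \<and> l = - int m - j \<or>
    i = int m \<and> - int m - 1 \<le> j \<and> j \<le> 0 \<and> l = - int m - 1 - j \<or>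
    l = - int m - 1 \<and> 1 \<le> j \<and> j \<le> int m - 1 \<and> i = int m - j \<or>
    l = - int m - 1 \<and> 1 \<le> j \<and> j \<le> int m \<and> i = int m + 1 - j"
proof -
  have "(i, j, l) \<in> (\<lambda>j. (int m, j, - int m - j)) ` {- int m..0} \<longleftrightarrow>
      i = int m \<and> - int m \<le> j \<and> j \<le> 0 \<and> l = - int m - j" by auto
  moreover have "(i, j, l) \<in> (\<lambda>j. (int m, j, - int m - 1 - j)) ` {- int m - 1..0} \<longleftrightarrow>
      i = int m \<and> - int m - 1 \<le> j \<and> j \<le> 0 \<and> l = - int m - 1 - j" by auto
  moreover have "(i, j, l) \<in> (\<lambda>j. (int m - j, j, - int m - 1)) ` {1..int m - 1} \<longleftrightarrow>
      l = - int m - 1 \<and> 1 \<le> j \<and> j \<le> int m - 1 \<and> i = int m - j" by auto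
  moreover have "(i, j, l) \<in> (\<lambda>j. (int m + 1 - j, j, - int m - 1)) ` {1..int m} \<longleftrightarrow>
      l = - int m - 1 \<and> 1 \<le> j \<and> j \<le> int m \<and> i = int m + 1 - j" by auto
  ultimately show ?thesis unfolding ring_sector_def Un_iff by (simp only: disj_assoc)
qed

text \<open>A triangle of the ring has some coordinate equal to m or -m-1. \<open>A\<close> and
  \<open>B\<close> treat these two kinds of side; near the corners the triangle may belong to a
  rotated sector.\<close>

lemma ring_cases:
  assumes "t \<in> hexagon (Suc m)" "t \<notin> hexagon m"
  shows "t \<in> ring_sector m \<or> rot t \<in> ring_sector m \<or> rot (rot t) \<in> ring_sector m"
proof -
  have A: "(int m, j, l) \<in> ring_sector m \<or> (l, int m, j) \<in> ring_sector m"
    if "(int m, j, l) \<in> hexagon (Suc m)" for j l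
  proof -
    have b: "- int m - 1 \<le> j" "- int m - 1 \<le> l" "int m + j + l = 0 \<or> int m + j + l = -1"
      using that unfolding in_hexagon by auto
    then consider "l = - int m - 1 - j" "j \<le> 0" | "j = 1" "l = - int m - 1"
      | "j = - int m - 1" "l = 1" | "l = - int m - j" "- int m \<le> j" "j \<le> 0" by linarith
    then show ?thesis
    proof cases
      case 1 then show ?thesis using b by (simp add: in_ring_sector)
    next
      case 2 then show ?thesis using that by (simp add: in_ring_sector in_hexagon)
    next
      case 3 then show ?thesis using that by (simp add: in_ring_sector in_hexagon)
    next
      case 4 then show ?thesis by (simp add: in_ring_sector)
    qed
  qed
  have B: "(i, j, - int m - 1) \<in> ring_sector m \<or> (j, - int m - 1, i) \<in> ring_sector m"
    if "(i, j, - int m - 1) \<in> hexagon (Suc m)" for i j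
  proof -
    have b: "i \<le> int m" "j \<le> int m" "i + j = int m + 1 \<or> i + j = int m"
      using that unfolding in_hexagon by auto
    then consider "i = int m + 1 - j" "1 \<le> j" | "i = int m" "j = 0" | "i = 0" "j = int m"
      | "i = int m - j" "1 \<le> j" "j \<le> int m - 1" by linarith
    then show ?thesis
    proof cases
      case 1 then show ?thesis using b by (simp add: in_ring_sector)
    next
      case 2 then show ?thesis by (simp add: in_ring_sector)
    next
      case 3 then show ?thesis by (simp add: in_ring_sector)
    next
      case 4 then show ?thesis by (simp add: in_ring_sector)
    qed
  qed
  obtain i j l where t: "t = (i, j, l)" by (cases t)
  have r: "rot t \<in> hexagon (Suc m)" "rot (rot t) \<in> hexagon (Suc m)"
    using assms(1) rot_hexagon by blast+
  have "i = int m \<or> j = int m \<or> l = int m \<or> i = - int m - 1 \<or> j = - int m - 1 \<or> l = - int m - 1"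
  proof (rule ccontr)
    assume "\<not> ?thesis"
    moreover have "- int m - 1 \<le> i" "i \<le> int m" "- int m - 1 \<le> j" "j \<le> int m"
      "- int m - 1 \<le> l" "l \<le> int m" "i + j + l = 0 \<or> i + j + l = -1"
      using assms(1) unfolding t in_hexagon by simp_all
    ultimately show False using assms(2) unfolding t in_hexagon by simp
  qed
  then consider "i = int m" | "j = int m" | "l = int m"
    | "i = - int m - 1" | "j = - int m - 1" | "l = - int m - 1" by blast
  then show ?thesis
  proof cases
    case 1 then show ?thesis using A[of j l] assms(1) unfolding t by auto
  next
    case 2 then show ?thesis using A[of l i] r unfolding t by auto
  next
    case 3 then show ?thesis using A[of i j] r unfolding t by auto
  next
    case 4 then show ?thesis using B[of j l] r unfolding t by auto
  next
    case 5 then show ?thesis using B[of l i] r unfolding t by auto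
  next
    case 6 then show ?thesis using B[of i j] assms(1) unfolding t by auto
  qed
qed

definition walk :: "nat \<Rightarrow> (tri \<times> tri) set" where
  "walk k = {(a, b). a \<in> perforated k \<and> b \<in> perforated k \<and> adj a b}\<^sup>*"

lemma perforated_mono: "m \<le> k \<Longrightarrow> perforated m \<subseteq> perforated k"
  by (auto simp: perforated_def in_hexagon)

lemma walk_mono: "m \<le> k \<Longrightarrow> walk m \<subseteq> walk k"
  unfolding walk_def using perforated_mono by (intro rtrancl_mono) blast

text \<open>The invariant for one step of the induction on k: triangles kept in the new ring are
  joined to the smaller perforated hexagon.\<close>

definition returns :: "nat \<Rightarrow> tri \<Rightarrow> bool" where
  "returns m t \<longleftrightarrow> (\<exists>u\<in>perforated m. (t, u) \<in> walk (Suc m))"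

lemma returns_base: "t \<in> perforated (Suc m) \<Longrightarrow> adj t u \<Longrightarrow> u \<in> perforated m \<Longrightarrow> returns m t"
  unfolding returns_def walk_def using perforated_mono[of m "Suc m"] by (auto intro!: bexI[of _ u])

lemma returns_step:
  assumes "t \<in> perforated (Suc m)" "u \<in> perforated (Suc m)" "adj t u" "returns m u"
  shows "returns m t"
proof -
  obtain v where "v \<in> perforated m" "(u, v) \<in> walk (Suc m)"
    using assms(4) unfolding returns_def by blast
  moreover from this(2) have "(t, v) \<in> walk (Suc m)"
    unfolding walk_def by (rule converse_rtrancl_into_rtrancl[rotated]) (use assms in blast)
  ultimately show ?thesis unfolding returns_def by blast
qed

lemma returns_rot:
  assumes "returns m t"
  shows "returns m (rot t)"
proof -
  obtain u where u: "u \<in> perforated m" "(t, u) \<in> walk (Suc m)"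
    using assms unfolding returns_def by blast
  have "(rot t, rot u) \<in> walk (Suc m)"
    using u(2) unfolding walk_def
  proof (induction rule: rtrancl_induct)
    case (step y z)
    have "(rot y, rot z) \<in> {(a, b). a \<in> perforated (Suc m) \<and> b \<in> perforated (Suc m) \<and> adj a b}"
      using step(2) by (simp add: rot_perforated)
    with step(3) show ?case by (rule rtrancl_into_rtrancl)
  qed simp
  then show ?thesis using u(1) rot_perforated unfolding returns_def by blast
qed

context
  fixes m :: nat
  assumes m: "1 \<le> m"
begin

lemma returns_long:
  assumes "- int m \<le> j" "j \<le> 0" "odd j"
  shows "returns m (int m, j, - int m - j)"
proof (rule returns_base)
  show "(int m, j, - int m - j) \<in> perforated (Suc m)"
    using assms m unfolding perforated_def Diff_iff in_hexagon in_hole_tris by simp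
  show "adj (int m, j, - int m - j) (int m - 1, j, - int m - j)" by (simp add: adj_iff)
  show "(int m - 1, j, - int m - j) \<in> perforated m"
    using assms m unfolding perforated_def Diff_iff in_hexagon in_hole_tris by simp
qed

lemma returns_short:
  assumes "1 \<le> j" "j \<le> int m - 1" "odd j"
  shows "returns m (int m - j, j, - int m - 1)"
proof (rule returns_base)
  show "(int m - j, j, - int m - 1) \<in> perforated (Suc m)"
    using assms unfolding perforated_def Diff_iff in_hexagon in_hole_tris by simp
  show "adj (int m - j, j, - int m - 1) (int m - j, j, - int m)" by (simp add: adj_iff)
  show "(int m - j, j, - int m) \<in> perforated m"
    using assms unfolding perforated_def Diff_iff in_hexagon in_hole_tris by simp
qed

lemma outer_short_perforated:
  assumes "1 \<le> j" "j \<le> int m"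
  shows "(int m + 1 - j, j, - int m - 1) \<in> perforated (Suc m)"
  using assms unfolding perforated_def Diff_iff in_hexagon in_hole_tris by simp

lemma outer_long_perforated:
  assumes "- int m - 1 \<le> j" "j \<le> 0"
  shows "(int m, j, - int m - 1 - j) \<in> perforated (Suc m)"
  using assms m unfolding perforated_def Diff_iff in_hexagon in_hole_tris by simp

lemma returns_outer_short:
  assumes "1 \<le> j" "j \<le> int m"
  shows "returns m (int m + 1 - j, j, - int m - 1)"
proof -
  note mem = outer_short_perforated[OF assms]
  consider "odd j" "j \<le> int m - 1" | "even j" | "odd j" "j = int m" using assms by linarith
  then show ?thesis
  proof cases
    case 1
    have "adj (int m + 1 - j, j, - int m - 1) (int m - j, j, - int m - 1)" by (simp add: adj_iff)
    moreover have "(int m - j, j, - int m - 1) \<in> perforated (Suc m)"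
      using assms 1 unfolding perforated_def Diff_iff in_hexagon in_hole_tris by simp
    ultimately show ?thesis using returns_step[OF mem] returns_short 1 assms by blast
  next
    case 2
    then have j: "2 \<le> j" using assms by presburger
    have "adj (int m + 1 - j, j, - int m - 1) (int m - (j - 1), j - 1, - int m - 1)"
      by (simp add: adj_iff)
    moreover have "(int m - (j - 1), j - 1, - int m - 1) \<in> perforated (Suc m)"
      using assms 2 j unfolding perforated_def Diff_iff in_hexagon in_hole_tris by simp
    moreover have "returns m (int m - (j - 1), j - 1, - int m - 1)"
      using assms 2 j by (intro returns_short) auto
    ultimately show ?thesis using returns_step[OF mem] by blast
  next
    case 3
    \<comment> \<open>At this end of the short side there is no inner triangle with index j. The
      path turns the corner into a rotated sector, where \<open>b\<close> is kept because m is odd,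
      and enters \<open>hexagon m\<close> at \<open>c\<close>.\<close>
    define a b c where "a = (0::int, int m, - int m - 1)" and "b = (0::int, int m, - int m)"
      and "c = (0::int, int m - 1, - int m)"
    have p: "a \<in> perforated (Suc m)" "b \<in> perforated (Suc m)" "c \<in> perforated m"
      using assms 3 unfolding a_def b_def c_def perforated_def Diff_iff in_hexagon in_hole_tris
      by simp_all
    have ad: "adj (int m + 1 - j, j, - int m - 1) a" "adj a b" "adj b c"
      using 3 by (simp_all add: a_def b_def c_def adj_iff)
    show ?thesis
      using returns_step[OF mem p(1) ad(1)] returns_step[OF p(1,2) ad(2)] returns_base[OF p(2) ad(3) p(3)]
      by blast
  qed
qed

lemma returns_outer_long:
  assumes "- int m - 1 \<le> j" "j \<le> 0"
  shows "returns m (int m, j, - int m - 1 - j)"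
proof -
  note mem = outer_long_perforated[OF assms]
  \<comment> \<open>Odd j steps inwards directly, and even j uses the kept inner triangle at j + 1.
    The two ends of the long side pass to the adjoining outer short sides.\<close>
  consider "odd j" "- int m \<le> j" | "even j" "j \<le> -2" | "j = 0" | "even (int m)" "j = - int m - 1"
  proof -
    have "odd j \<and> - int m \<le> j \<or> even j \<and> j \<le> -2 \<or> j = 0 \<or> even (int m) \<and> j = - int m - 1"
      using assms by presburger
    then show thesis using that by blast
  qed
  then show ?thesis
  proof cases
    case 1
    have "adj (int m, j, - int m - 1 - j) (int m, j, - int m - j)" by (simp add: adj_iff)
    moreover have "(int m, j, - int m - j) \<in> perforated (Suc m)"
      using assms 1 m unfolding perforated_def Diff_iff in_hexagon in_hole_tris by simp
    ultimately show ?thesis using returns_step[OF mem] returns_long 1 assms by blast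
  next
    case 2
    have "adj (int m, j, - int m - 1 - j) (int m, j + 1, - int m - (j + 1))" by (simp add: adj_iff)
    moreover have "(int m, j + 1, - int m - (j + 1)) \<in> perforated (Suc m)"
      using assms 2 m unfolding perforated_def Diff_iff in_hexagon in_hole_tris by simp
    moreover have "returns m (int m, j + 1, - int m - (j + 1))"
      using assms 2 by (intro returns_long) auto
    ultimately show ?thesis using returns_step[OF mem] by blast
  next
    case 3
    have "adj (int m, j, - int m - 1 - j) (int m + 1 - 1, 1, - int m - 1)" using 3 by (simp add: adj_iff)
    then show ?thesis
      using returns_step[OF mem] outer_short_perforated[of 1] returns_outer_short[of 1] m by simp
  next
    case 4
    have "returns m (rot (int m + 1 - int m, int m, - int m - 1))"
      using m by (intro returns_rot returns_outer_short) auto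
    then have "returns m (int m, - int m - 1, 1)" by simp
    moreover have "rot (int m + 1 - int m, int m, - int m - 1) \<in> perforated (Suc m)"
      unfolding rot_perforated using m by (intro outer_short_perforated) auto
    then have "(int m, - int m - 1, 1) \<in> perforated (Suc m)" by simp
    moreover have "adj (int m, j, - int m - 1 - j) (int m, - int m - 1, 1)" using 4 by (simp add: adj_iff)
    ultimately show ?thesis using returns_step[OF mem] by blast
  qed
qed

lemma returns_sector:
  assumes "t \<in> ring_sector m" "t \<notin> hole_tris"
  shows "returns m t"
proof -
  obtain i j l where t: "t = (i, j, l)" by (cases t)
  consider "i = int m" "- int m \<le> j" "j \<le> 0" "l = - int m - j"
    | "i = int m" "- int m - 1 \<le> j" "j \<le> 0" "l = - int m - 1 - j"
    | "l = - int m - 1" "1 \<le> j" "j \<le> int m - 1" "i = int m - j"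
    | "l = - int m - 1" "1 \<le> j" "j \<le> int m" "i = int m + 1 - j"
    using assms(1) unfolding t in_ring_sector by blast
  then show ?thesis
  proof cases
    case 1
    then have "odd j" using assms(2) m unfolding t in_hole_tris by auto
    then show ?thesis using returns_long 1 t by simp
  next
    case 2
    then show ?thesis using returns_outer_long t by simp
  next
    case 3
    then have "odd j" using assms(2) m unfolding t in_hole_tris by auto
    then show ?thesis using returns_short 3 t by simp
  next
    case 4
    then show ?thesis using returns_outer_short t by simp
  qed
qed

lemma returns_ring:
  assumes "t \<in> perforated (Suc m)" "t \<notin> hexagon m"
  shows "returns m t"
proof -
  have t: "t \<in> hexagon (Suc m)" "t \<notin> hole_tris" using assms(1) by (auto simp: perforated_def)
  consider "t \<in> ring_sector m" | "rot t \<in> ring_sector m" | "rot (rot t) \<in> ring_sector m"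
    using ring_cases[OF t(1) assms(2)] by blast
  then show ?thesis
  proof cases
    case 1 then show ?thesis using returns_sector t(2) by blast
  next
    case 2
    then have "returns m (rot t)" using returns_sector t(2) rot_hole_tris by blast
    then show ?thesis using returns_rot[of m "rot t"] returns_rot[of m "rot (rot t)"] by simp
  next
    case 3
    then have "returns m (rot (rot t))" using returns_sector t(2) rot_hole_tris by blast
    then show ?thesis using returns_rot[of m "rot (rot t)"] by simp
  qed
qed

end

lemma hexagon_1: "hexagon (Suc 0) \<subseteq> {(0, 0, 0), (-1, 0, 0), (0, -1, 0), (0, 0, -1)}"
proof
  fix t assume t: "t \<in> hexagon (Suc 0)"
  obtain i j l where ijl: "t = (i, j, l)" by (cases t)
  have "(i = 0 \<or> i = -1) \<and> (j = 0 \<or> j = -1) \<and> (l = 0 \<or> l = -1) \<and> (i + j + l = 0 \<or> i + j + l = -1)"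
    using t unfolding ijl in_hexagon by simp linarith
  then show "t \<in> {(0, 0, 0), (-1, 0, 0), (0, -1, 0), (0, 0, -1)}"
    unfolding ijl by (elim conjE disjE) simp_all
qed

lemma perforated_reaches_centre:
  assumes "1 \<le> k" "t \<in> perforated k"
  shows "(t, (0, 0, 0)) \<in> walk k"
  using assms
proof (induction k arbitrary: t rule: nat_induct_at_least)
  case base
  have c: "(0, 0, 0) \<in> perforated (Suc 0)"
    unfolding perforated_def Diff_iff in_hexagon in_hole_tris by simp
  have "t = (0, 0, 0) \<or> adj t (0, 0, 0)"
    using hexagon_1 base by (auto simp: perforated_def adj_iff)
  then show ?case using base c unfolding walk_def by auto
next
  case (Suc m)
  have W: "walk m \<subseteq> walk (Suc m)" by (rule walk_mono) simp
  show ?case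
  proof (cases "t \<in> hexagon m")
    case True
    then have "t \<in> perforated m" using Suc.prems by (simp add: perforated_def)
    then show ?thesis using Suc.IH W by blast
  next
    case False
    then obtain u where "u \<in> perforated m" "(t, u) \<in> walk (Suc m)"
      using returns_ring[OF Suc.hyps Suc.prems] unfolding returns_def by blast
    moreover from this(1) have "(u, (0, 0, 0)) \<in> walk (Suc m)" using Suc.IH W by blast
    ultimately show ?thesis unfolding walk_def by (meson rtrancl_trans)
  qed
qed

lemma edge_connected_perforated: "1 \<le> k \<Longrightarrow> edge_connected (perforated k)"
  using edge_connected_if_reachable[of "perforated k" "(0, 0, 0)"] perforated_reaches_centre
  unfolding walk_def by blast

section \<open>Counting tiles and holes\<close>

lemma card_ring_sector: "card (ring_sector m) \<le> 4 * m + 2" if "1 \<le> m"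
proof -
  have "card (ring_sector m) \<le> card {- int m..0} + card {- int m - 1..0} + card {1..int m - 1} + card {1..int m}"
    unfolding ring_sector_def
    by (intro order.trans[OF card_Un_le] add_mono card_image_le) auto
  also have "\<dots> = 4 * m + 2" using that by simp
  finally show ?thesis .
qed

text \<open>Three sectors of 4 m + 2 triangles match 6 (m + 1)^2 - 6 m^2 = 12 m + 6. This upper
  bound and the lower bound on holes become equalities through
  \<open>extremal_arith\<close>.\<close>

lemma card_hexagon: "1 \<le> k \<Longrightarrow> card (hexagon k) + 2 \<le> 6 * k\<^sup>2"
proof (induction k rule: nat_induct_at_least)
  case base
  have "card (hexagon (Suc 0)) \<le> card {(0::int, 0::int, 0::int), (-1, 0, 0), (0, -1, 0), (0, 0, -1)}"
    by (rule card_mono[OF _ hexagon_1]) simp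
  then show ?case by simp
next
  case (Suc m)
  define R where "R = ring_sector m"
  have finR: "finite R" by (simp add: R_def ring_sector_def)
  have "hexagon (Suc m) \<subseteq> hexagon m \<union> (R \<union> (rot ` R \<union> rot ` rot ` R))"
  proof
    fix t assume "t \<in> hexagon (Suc m)"
    then have "t \<in> hexagon m \<or> t \<in> R \<or> rot t \<in> R \<or> rot (rot t) \<in> R"
      using ring_cases unfolding R_def by blast
    then show "t \<in> hexagon m \<union> (R \<union> (rot ` R \<union> rot ` rot ` R))"
      by (metis UnCI image_eqI rot_rot_rot)
  qed
  then have "card (hexagon (Suc m)) \<le> card (hexagon m \<union> (R \<union> (rot ` R \<union> rot ` rot ` R)))"
    using finR finite_hexagon by (intro card_mono) auto
  also have "\<dots> \<le> card (hexagon m) + (card R + (card R + card R))"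
    using card_image_le[OF finR, of rot] card_image_le[of "rot ` R" rot] finR
    by (intro order.trans[OF card_Un_le] add_mono) (auto intro: order.trans)
  also have "\<dots> \<le> card (hexagon m) + (12 * m + 6)"
    using card_ring_sector[OF Suc.hyps] by (simp add: R_def)
  finally show ?case using Suc.IH by (simp add: power2_eq_square)
qed

lemma card_holes: "1 \<le> k \<Longrightarrow> 3 * k\<^sup>2 \<le> 2 * card (hexagon k \<inter> hole_tris) + 3 * k"
proof (induction k rule: nat_induct_at_least)
  case (Suc m)
  \<comment> \<open>\<open>J\<close> enumerates m consecutive even numbers between -m and m - 1, and
    \<open>h\<close> places a hole at each in the chain of length 2 m. With the two rotations the
    ring gets 3 m holes.\<close>
  define J where "J q = 2 * (int q - int (m div 2))" for q
  define h where "h q = (if J q \<le> 0 then (int m, J q, - int m - J q) else (int m - J q, J q, - int m - 1))" for q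
  define N where "N = h ` {..<m}"
  have J: "- int m \<le> J q" "J q \<le> int m - 1" "even (J q)" if "q < m" for q
    using that by (auto simp: J_def)
  have fin: "finite N" by (simp add: N_def)
  have "inj_on h {..<m}" by (rule inj_onI) (auto simp: h_def J_def split: if_splits)
  then have cardN: "card N = m" unfolding N_def by (simp add: card_image)
  have N1: "t \<in> hexagon (Suc m) \<inter> sector_holes" "t \<notin> hexagon m" if tN: "t \<in> N" for t
  proof -
    obtain q where "q < m" and t: "t = h q" using tN unfolding N_def by blast
    note J = J[OF this(1)]
    show "t \<in> hexagon (Suc m) \<inter> sector_holes" "t \<notin> hexagon m"
      using J Suc.hyps unfolding t h_def by (auto simp: in_hexagon sector_holes_def)
  qed
  \<comment> \<open>The signs of the coordinates determine the sector of a hole.\<close>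
  have sec: "rot t \<notin> sector_holes" "rot (rot t) \<notin> sector_holes" if "t \<in> sector_holes" for t
    using that by (cases t; auto simp: sector_holes_def)+
  have dis: "N \<inter> rot ` N = {}" "N \<inter> rot ` rot ` N = {}" "rot ` N \<inter> rot ` rot ` N = {}"
  proof -
    show *: "N \<inter> rot ` N = {}" using N1(1) sec(1) by blast
    show "N \<inter> rot ` rot ` N = {}" using N1(1) sec(2) by blast
    have "rot ` N \<inter> rot ` rot ` N = rot ` (N \<inter> rot ` N)" by (rule image_Int[OF inj_rot, symmetric])
    then show "rot ` N \<inter> rot ` rot ` N = {}" unfolding * by simp
  qed
  have c: "card (rot ` N) = m" "card (rot ` rot ` N) = m"
    using cardN by (simp_all add: card_image inj_on_subset[OF inj_rot])
  have "card (hexagon m \<inter> hole_tris) + 3 * m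
      = card (hexagon m \<inter> hole_tris) + card (N \<union> (rot ` N \<union> rot ` rot ` N))"
    using fin dis c cardN by (simp add: card_Un_disjoint Int_Un_distrib)
  also have "\<dots> = card (hexagon m \<inter> hole_tris \<union> (N \<union> (rot ` N \<union> rot ` rot ` N)))"
  proof (rule card_Un_disjoint[symmetric])
    show "hexagon m \<inter> hole_tris \<inter> (N \<union> (rot ` N \<union> rot ` rot ` N)) = {}"
      using N1(2) rot_hexagon by blast
  qed (use fin finite_hexagon in auto)
  also have "\<dots> \<le> card (hexagon (Suc m) \<inter> hole_tris)"
  proof (rule card_mono)
    have "N \<subseteq> hexagon (Suc m) \<inter> hole_tris" using N1(1) unfolding hole_tris_def by blast
    moreover have "hexagon m \<subseteq> hexagon (Suc m)" by (auto simp: in_hexagon)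
    ultimately show "hexagon m \<inter> hole_tris \<union> (N \<union> (rot ` N \<union> rot ` rot ` N)) \<subseteq> hexagon (Suc m) \<inter> hole_tris"
      using rot_hexagon rot_hole_tris by blast
  qed (simp add: finite_hexagon)
  finally show ?case using Suc.IH by (simp add: power2_eq_square)
qed simp

section \<open>Extremal arithmetic and the theorem\<close>

text \<open>With j tiles saved and e extra holes, x = j + 3 e shortens the outer perimeter to at
  most 6 k - x, while 6 (n + b) = 36 k^2 - 12 - 6 j + 6 e. For 1 <= x <= 6 k this violates the
  isoperimetric bound.\<close>

lemma extremal_arith:
  fixes k h n b p N :: nat
  assumes "2 \<le> k" "2 * h + 3 * k = 3 * k\<^sup>2" "2 * N + 4 = 9 * k\<^sup>2 + 3 * k" "h \<le> b" "n \<le> N"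
    and "3 * b + p \<le> n + 2" "6 * (n + b) \<le> p\<^sup>2"
  shows "n = N \<and> b = h"
proof (rule ccontr)
  assume neq: "\<not> (n = N \<and> b = h)"
  define j e x K where "j = int N - int n" and "e = int b - int h" and "x = j + 3 * e" and "K = int k"
  have je: "0 \<le> j" "0 \<le> e" "1 \<le> x" using assms(4,5) neq by (auto simp: j_def e_def x_def)
  have jx: "j \<le> x" using je(2) by (simp add: x_def)
  have hN: "2 * int h = 3 * K\<^sup>2 - 3 * K" "2 * int N = 9 * K\<^sup>2 + 3 * K - 4"
    using arg_cong[OF assms(2), of int] arg_cong[OF assms(3), of int] by (simp_all add: K_def)
  have K: "2 \<le> K" using assms(1) by (simp add: K_def)
  have p: "int p \<le> 6 * K - x"
  proof -
    have "3 * int b + int p \<le> int n + 2" using assms(6) by linarith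
    then show ?thesis using hN unfolding x_def j_def e_def by (simp add: algebra_simps)
  qed
  then have xK: "x \<le> 6 * K" by linarith
  have "(int p)\<^sup>2 \<le> (6 * K - x)\<^sup>2" using p by (intro power_mono) auto
  moreover have "int (6 * (n + b)) \<le> int (p\<^sup>2)" using assms(7) by (simp only: of_nat_le_iff)
  moreover have "int (6 * (n + b)) = 36 * K\<^sup>2 - 12 - 6 * j + 6 * e"
    using hN unfolding j_def e_def by (simp add: algebra_simps)
  ultimately have "36 * K\<^sup>2 - 12 - 6 * j + 6 * e \<le> (6 * K - x)\<^sup>2" by simp
  then have "12 * (K * x) \<le> x * x + 12 + 6 * j - 6 * e"
    by (simp add: power2_eq_square algebra_simps)
  then have 1: "12 * (K * x) \<le> x * x + 12 + 6 * x" using je jx by linarith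
  \<comment> \<open>This says that x (12 K - 6 - x) is at least 12 K - 7, its value at x = 1. That
    value exceeds 12 once K >= 2.\<close>
  have "0 \<le> (x - 1) * (12 * K - 7 - x)" using je xK K by (intro mult_nonneg_nonneg) auto
  then have "x * x + 12 * K + 6 * x - 7 \<le> 12 * (K * x)" by (simp add: algebra_simps)
  then show False using 1 K by linarith
qed

theorem theorem1:
  fixes k :: nat
  assumes "k > 1"
  shows "g_tri ((3 * k^2 - 3 * k) div 2) = (9 * k^2 + 3 * k - 4) div 2"
proof -
  define h N where "h = (3 * k\<^sup>2 - 3 * k) div 2" and "N = (9 * k\<^sup>2 + 3 * k - 4) div 2"
  define B where "B T = {C \<in> components (- \<Union>T). bounded C}" for T :: "complex set set"
  \<comment> \<open>The substitution removes truncated subtraction and exposes the parity needed for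
    the divisions by 2.\<close>
  obtain d where d: "k = d + 2" using assms that[of "k - 2"] by simp
  have h: "2 * h + 3 * k = 3 * k\<^sup>2" and N: "2 * N + 4 = 9 * k\<^sup>2 + 3 * k"
  proof -
    have "even (3 * k\<^sup>2 - 3 * k)" "even (9 * k\<^sup>2 + 3 * k - 4)" unfolding d by (auto simp: power2_eq_square)
    then have "2 * h = 3 * k\<^sup>2 - 3 * k" "2 * N = 9 * k\<^sup>2 + 3 * k - 4" by (simp_all add: h_def N_def)
    then show "2 * h + 3 * k = 3 * k\<^sup>2" "2 * N + 4 = 9 * k\<^sup>2 + 3 * k"
      unfolding d by (simp_all add: power2_eq_square)
  qed
  have k2: "2 \<le> k" using assms by simp
  \<comment> \<open>Used twice: to make the counts of the construction exact, and to exclude smaller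
    polyiamonds.\<close>
  have bound: "card T = N \<and> card (B T) = h"
    if T: "polyiamond_tiles T" "finite (B T)" "h \<le> card (B T)" "card T \<le> N" for T
  proof -
    obtain p where "3 * card (B T) + p \<le> card T + 2" "6 * (card T + card (B T)) \<le> p\<^sup>2"
      using holes_inequality[OF T(1,2)] unfolding B_def by auto
    then show ?thesis using extremal_arith[OF k2 h N] T by blast
  qed
  show ?thesis
    unfolding g_tri_def h_def[symmetric] N_def[symmetric]
  proof (rule Least_equality)
    define I where "I = perforated k"
    define T where "T = cell ` I"
    have I: "finite I" "I \<subseteq> tris" unfolding I_def perforated_def using finite_hexagon hexagon_tris by auto
    have "(0, 0, 0) \<in> I" using assms unfolding I_def perforated_def Diff_iff in_hexagon in_hole_tris by simp
    then have T: "polyiamond_tiles T"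
      unfolding polyiamond_tiles_def T_def tiles_eq
      using I interior_connected_if_edge_connected[OF I] edge_connected_perforated[of k] assms
      by (auto simp: I_def)
    have cardT: "card T = card I"
      unfolding T_def by (rule card_image[OF inj_on_subset[OF inj_on_cell I(2)]])
    have finB: "finite (B T)"
    proof -
      \<comment> \<open>Every finite family of holes obeys the same bound, so the set of all holes
        is finite and its \<open>card\<close> is meaningful.\<close>
      have "card \<C> \<le> card T + 2" if "\<C> \<subseteq> B T" "finite \<C>" for \<C>
        by (rule holes_inequality[OF T that(2) that(1)[unfolded B_def]]) linarith
      then show ?thesis using finite_if_finite_subsets_card_bdd by blast
    qed
    have sub: "ocell ` (hexagon k \<inter> hole_tris) \<subseteq> B T"
    proof (rule image_subsetI)
      fix t assume t: "t \<in> hexagon k \<inter> hole_tris"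
      then have "t \<in> tris - I" using hexagon_tris by (auto simp: I_def perforated_def)
      moreover have "\<And>t'. adj t t' \<Longrightarrow> t' \<in> I" using t hole_isolated unfolding I_def by blast
      ultimately show "ocell t \<in> B T"
        using ocell_component[OF I(2)] unfolding B_def T_def by blast
    qed
    have inj: "inj_on ocell (hexagon k \<inter> hole_tris)"
    proof (rule inj_onI)
      fix t u assume tu: "t \<in> hexagon k \<inter> hole_tris" "u \<in> hexagon k \<inter> hole_tris" "ocell t = ocell u"
      then have "t \<in> tris" "u \<in> tris" using hexagon_tris by auto
      moreover obtain z where "z \<in> ocell t" using ocell_nonempty calculation(1) by blast
      ultimately show "t = u" using cell_meets_rhombus[of t t u z] tu(3) ocell_subset_cell[of u] by auto
    qed
    have le: "card (hexagon k \<inter> hole_tris) \<le> card (B T)"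
      using card_inj_on_le[OF inj sub finB] .
    have "card (hexagon k) = card I + card (hexagon k \<inter> hole_tris)"
      unfolding I_def perforated_def
      by (metis Diff_Int_distrib2 add.commute card_Diff_subset_Int card_Int_Diff finite_hexagon)
    \<comment> \<open>At most 6 k^2 - 2 triangles minus at least h holes leaves at most N tiles. By
      \<open>bound\<close> both counts are exact, so there are no holes besides the single-triangle
      ones.\<close>
    then have "card T \<le> N" "h \<le> card (B T)"
      using cardT le card_hexagon[of k] card_holes[of k] h N k2 by linarith+
    then have "card T = N \<and> holes (\<Union>T) = h"
      using bound[OF T finB] by (simp add: holes_def B_def)
    then show "\<exists>T. polyiamond_tiles T \<and> holes (\<Union>T) = h \<and> card T = N" using T by blast
  next
    fix n assume "\<exists>T. polyiamond_tiles T \<and> holes (\<Union>T) = h \<and> card T = n"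
    then obtain T where T: "polyiamond_tiles T" "card (B T) = h" "card T = n"
      by (auto simp: holes_def B_def)
    \<comment> \<open>An infinite set has \<open>card\<close> 0, so a positive hole count implies
      finiteness.\<close>
    have "0 < h" using h unfolding d by (simp add: power2_eq_square)
    then have "finite (B T)" using T(2) card_ge_0_finite by auto
    then show "N \<le> n" using bound[OF T(1)] T(2,3) by (cases "n \<le> N") auto
  qed
qed

end
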